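(* Let $\Gamma\subset\mathbb{H}^2\times\{t_0\}$ be a closed embedded curve which is invariant under rotations around a vertical axis $l$ of $\mathbb{H}^2\times\mathbb{R}$. Let $M$ be a compact embedded translating soliton with boundary $\partial M=\Gamma$. Then $M$ is rotationally symmetric and, up to translations, is a piece of the bowl soliton.
   Context: $\mathbb{H}^2\times\mathbb{R}$ carries the product metric $\langle\cdot,\cdot\rangle$ of the hyperbolic plane of curvature $-1$ and the real line; $\partial_z$ is the unit vertical field. A vertical axis is a line $\{o\}\times\mathbb{R}$, $o\in\mathbb{H}^2$; rotations around it are the isometries $(x,z)\mapsto(\rho(x),z)$ with $\rho$ a hyperbolic rotation fixing $o$. An oriented immersed surface $M$ with unit normal $\eta$ and mean curvature $H_M$ (half the trace of the second fundamental form with respect to $\eta$) is a translating soliton if $H_M=\langle\eta,\partial_z\rangle$. The bowl soliton is the (unique up to vertical translation) upwards-oriented translating soliton which is an entire vertical graph over $\mathbb{H}^2$ and rotationally symmetric about a vertical axis. *)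

theory Defs
  imports "HOL-Analysis.Analysis"
begin

text \<open>Model: H^2 x R is the hypersurface of R^4 (coordinates 1,2,3 = hyperboloid model
of H^2 in Minkowski space R^{2,1}, coordinate 4 = height z).  The product metric is
the restriction of the flat form mink below (signature (+,+,-,+)), which is positive
definite on the tangent spaces of H^2 x R.\<close>

definition mink :: "real^4 \<Rightarrow> real^4 \<Rightarrow> real" where
  "mink x y = x$1 * y$1 + x$2 * y$2 - x$3 * y$3 + x$4 * y$4"

definition HxR :: "(real^4) set" where
  "HxR = {x. (x$1)^2 + (x$2)^2 - (x$3)^2 = -1 \<and> x$3 > 0}"

definition ez :: "real^4" where "ez = axis 4 1"

definition hpart :: "real^4 \<Rightarrow> real^4" where
  "hpart x = vector [x$1, x$2, x$3, 0]"

text \<open>A vertical axis {o} x R is given by a point a = (o,0) of H^2 x {0}.\<close>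
definition vaxis :: "real^4 \<Rightarrow> bool" where
  "vaxis a \<longleftrightarrow> a \<in> HxR \<and> a$4 = 0"

text \<open>Rotations around the vertical axis through a: maps (x,z) \<mapsto> (rho x, z) with rho a
hyperbolic rotation fixing o, i.e. linear Lorentz maps fixing o, of determinant 1,
extended by the identity on the height coordinate.\<close>
definition vrot :: "real^4 \<Rightarrow> (real^4 \<Rightarrow> real^4) \<Rightarrow> bool" where
  "vrot a R \<longleftrightarrow> linear R \<and> (\<forall>x y. mink (R x) (R y) = mink x y) \<and> R ez = ez \<and> R a = a
     \<and> det (matrix R) = 1"

definition rot_invariant :: "real^4 \<Rightarrow> (real^4) set \<Rightarrow> bool" where
  "rot_invariant a S \<longleftrightarrow> (\<forall>R. vrot a R \<longrightarrow> R ` S = S)"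

definition C2_param :: "(real \<times> real) set \<Rightarrow> (real \<times> real \<Rightarrow> real^4)
   \<Rightarrow> (real \<times> real \<Rightarrow> real^4) \<Rightarrow> (real \<times> real \<Rightarrow> real^4)
   \<Rightarrow> (real \<times> real \<Rightarrow> real^4) \<Rightarrow> (real \<times> real \<Rightarrow> real^4) \<Rightarrow> (real \<times> real \<Rightarrow> real^4) \<Rightarrow> bool" where
  "C2_param U \<phi> \<phi>u \<phi>v \<phi>uu \<phi>uv \<phi>vv \<longleftrightarrow> open U \<and>
     (\<forall>(s,t)\<in>U.
        ((\<lambda>s'. \<phi> (s',t)) has_vector_derivative \<phi>u (s,t)) (at s) \<and>
        ((\<lambda>t'. \<phi> (s,t')) has_vector_derivative \<phi>v (s,t)) (at t) \<and>
        ((\<lambda>s'. \<phi>u (s',t)) has_vector_derivative \<phi>uu (s,t)) (at s) \<and>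
        ((\<lambda>t'. \<phi>u (s,t')) has_vector_derivative \<phi>uv (s,t)) (at t) \<and>
        ((\<lambda>s'. \<phi>v (s',t)) has_vector_derivative \<phi>uv (s,t)) (at s) \<and>
        ((\<lambda>t'. \<phi>v (s,t')) has_vector_derivative \<phi>vv (s,t)) (at t)) \<and>
     continuous_on U \<phi>u \<and> continuous_on U \<phi>v \<and> continuous_on U \<phi>uu \<and>
     continuous_on U \<phi>uv \<and> continuous_on U \<phi>vv"

definition immersion :: "(real \<times> real) set \<Rightarrow> (real \<times> real \<Rightarrow> real^4)
   \<Rightarrow> (real \<times> real \<Rightarrow> real^4) \<Rightarrow> (real \<times> real \<Rightarrow> real^4) \<Rightarrow> bool" where
  "immersion U \<phi> \<phi>u \<phi>v \<longleftrightarrow> \<phi> ` U \<subseteq> HxR \<and>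
     (\<forall>q\<in>U. mink (\<phi>u q) (\<phi>u q) * mink (\<phi>v q) (\<phi>v q) - (mink (\<phi>u q) (\<phi>v q))^2 > 0)"

text \<open>Mean curvature (half the trace of the second fundamental form w.r.t. the unit
normal n) of a parametrised surface at a parameter point, in terms of first and
second derivatives; since n is tangent to H^2 x R, mink (\<phi>_ij) n = <\<nabla>_i \<phi>_j, n>.\<close>
definition mean_curv :: "real^4 \<Rightarrow> real^4 \<Rightarrow> real^4 \<Rightarrow> real^4 \<Rightarrow> real^4 \<Rightarrow> real^4 \<Rightarrow> real" where
  "mean_curv xu xv xuu xuv xvv n =
     (let E = mink xu xu; F = mink xu xv; G = mink xv xv;
          L = mink xuu n; M = mink xuv n; N = mink xvv n
      in (E * N - 2 * F * M + G * L) / (2 * (E * G - F^2)))"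

definition interior_chart :: "(real^4) set \<Rightarrow> real^4 \<Rightarrow> bool" where
  "interior_chart S p \<longleftrightarrow> (\<exists>U V \<phi> \<phi>u \<phi>v \<phi>uu \<phi>uv \<phi>vv \<psi>.
      C2_param U \<phi> \<phi>u \<phi>v \<phi>uu \<phi>uv \<phi>vv \<and> immersion U \<phi> \<phi>u \<phi>v \<and>
      open V \<and> p \<in> V \<and> homeomorphism U (S \<inter> V) \<phi> \<psi>)"

definition boundary_chart :: "(real^4) set \<Rightarrow> real^4 \<Rightarrow> bool" where
  "boundary_chart S p \<longleftrightarrow> (\<exists>U V \<phi> \<phi>u \<phi>v \<phi>uu \<phi>uv \<phi>vv \<psi>.
      C2_param U \<phi> \<phi>u \<phi>v \<phi>uu \<phi>uv \<phi>vv \<and> immersion U \<phi> \<phi>u \<phi>v \<and>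
      open V \<and> p \<in> V \<and> homeomorphism (U \<inter> {(s,t). t \<ge> 0}) (S \<inter> V) \<phi> \<psi> \<and>
      (\<exists>s. (s,0) \<in> U \<and> \<phi> (s,0) = p))"

definition emb_surface_bdry :: "(real^4) set \<Rightarrow> bool" where
  "emb_surface_bdry S \<longleftrightarrow> S \<subseteq> HxR \<and> (\<forall>p\<in>S. interior_chart S p \<or> boundary_chart S p)"

definition mbdry :: "(real^4) set \<Rightarrow> (real^4) set" where
  "mbdry S = {p\<in>S. \<not> interior_chart S p}"

definition emb_surface :: "(real^4) set \<Rightarrow> bool" where
  "emb_surface S \<longleftrightarrow> S \<subseteq> HxR \<and> (\<forall>p\<in>S. interior_chart S p)"

text \<open>A continuous unit normal field (orientation) on S: unit, tangent to H^2 x R and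
orthogonal to S (tested on all C^2 immersions into S).\<close>
definition unit_normal :: "(real^4) set \<Rightarrow> (real^4 \<Rightarrow> real^4) \<Rightarrow> bool" where
  "unit_normal S \<eta> \<longleftrightarrow> continuous_on S \<eta> \<and>
     (\<forall>p\<in>S. mink (\<eta> p) (\<eta> p) = 1 \<and> mink (\<eta> p) (hpart p) = 0) \<and>
     (\<forall>U \<phi> \<phi>u \<phi>v \<phi>uu \<phi>uv \<phi>vv. C2_param U \<phi> \<phi>u \<phi>v \<phi>uu \<phi>uv \<phi>vv \<and> immersion U \<phi> \<phi>u \<phi>v
        \<and> \<phi> ` U \<subseteq> S \<longrightarrow>
        (\<forall>q\<in>U. mink (\<eta> (\<phi> q)) (\<phi>u q) = 0 \<and> mink (\<eta> (\<phi> q)) (\<phi>v q) = 0))"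

definition translator :: "(real^4) set \<Rightarrow> (real^4 \<Rightarrow> real^4) \<Rightarrow> bool" where
  "translator S \<eta> \<longleftrightarrow> unit_normal S \<eta> \<and>
     (\<forall>U \<phi> \<phi>u \<phi>v \<phi>uu \<phi>uv \<phi>vv. C2_param U \<phi> \<phi>u \<phi>v \<phi>uu \<phi>uv \<phi>vv \<and> immersion U \<phi> \<phi>u \<phi>v
        \<and> \<phi> ` U \<subseteq> S \<longrightarrow>
        (\<forall>q\<in>U. mean_curv (\<phi>u q) (\<phi>v q) (\<phi>uu q) (\<phi>uv q) (\<phi>vv q) (\<eta> (\<phi> q))
                 = mink (\<eta> (\<phi> q)) ez))"

definition vgraph :: "(real^4 \<Rightarrow> real) \<Rightarrow> (real^4) set" where
  "vgraph u = {x\<in>HxR. x$4 = u (hpart x)}"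

definition bowl :: "(real^4) set \<Rightarrow> bool" where
  "bowl B \<longleftrightarrow> (\<exists>u. B = vgraph u) \<and> emb_surface B \<and>
     (\<exists>\<eta>. translator B \<eta> \<and> (\<forall>p\<in>B. mink (\<eta> p) ez > 0)) \<and>
     (\<exists>a. vaxis a \<and> rot_invariant a B)"

definition closed_emb_curve :: "(real^4) set \<Rightarrow> bool" where
  "closed_emb_curve \<Gamma> \<longleftrightarrow> (\<exists>\<gamma> :: real^2 \<Rightarrow> real^4. continuous_on (sphere 0 1) \<gamma> \<and>
      inj_on \<gamma> (sphere 0 1) \<and> \<Gamma> = \<gamma> ` sphere 0 1)"

end

(* In the hyperboloid model let w = - <x,a>, the hyperbolic cosine of the distance to the axis.
   A radial graph z = f(w) is a translator iff its slope g = f' solves a first order equation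
   with a regular singular point at w = 1; this gives the bowl.
   If z - v(w) restricted to a translator has an interior critical point where the Hessian is
   semidefinite, then the translator equation there compares the radial mean curvature of v
   with 2. For v = f - eps * w and eps small, that quantity lies strictly on the wrong side of 2
   on bounded sets, so z - f(w) + eps * w takes its maximum (its minimum, if eps < 0) over the
   compact soliton on the boundary. The boundary is a single circle of the rotation group, on which
   z and w are constant, so letting eps tend to 0 shows that z - f(w) is constant: the soliton lies on
   a translated bowl. *)

theory Submission
  imports Defs
begin

section \<open>The slope of the bowl\<close>

text \<open>The coordinate w replaces the distance to the axis because it is the restriction of a
  linear function on R^4: it is smooth on the axis itself, and its Hessian on the hyperbolic plane
  is w times the metric. For eps = 0 a touching point only compares 2 with 2, and a strong maximum
  principle would have to take over; the term eps * w makes the comparison strict. It shifts the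
  slope by a constant and leaves the second derivative alone, so the profile equation still cancels
  the terms of order zero in eps. The comparison takes place at critical points of z - v(w) on M,
  where the normal of M is a multiple of the normal of the graph. Both sides of the soliton equation
  are linear in the normal, so M may be any embedded surface with either orientation, not just a
  graph. Lying on a bowl does not yet make M symmetric, since M could be an irregular piece of it.
  Symmetry needs a separate open-and-closed argument on each orbit circle, and it works because the
  boundary is one entire orbit: every other orbit meets only interior points of M.\<close>

text \<open>Multiplied by w^2 - 1, the profile equation reads ((w^2 - 1) g)' = 2 + (w^2 - 1) g^2 (2 - w g).
Integrating from w = 1 and substituting w = 1 + s, t = 1 + s r turns it into the fixed point equation of
bowl_fixpoint_exists, which is regular at s = 0. The nonlinearity g^2 (2 - w g) is truncated
outside 0 <= g <= 2/w to make it globally Lipschitz; bowl_profile_exists shows that the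
solution never leaves this region.\<close>

definition truncated_cubic :: "real \<Rightarrow> real \<Rightarrow> real" where
  "truncated_cubic t y = (max 0 (min y (2/t)))\<^sup>2 * (2 - t * max 0 (min y (2/t)))"

lemma truncated_cubic_eq:
  assumes "t > 0" "0 \<le> y" "y * t \<le> 2"
  shows "truncated_cubic t y = y\<^sup>2 * (2 - t * y)"
proof -
  have "y \<le> 2/t" using assms by (simp add: field_simps)
  with assms show ?thesis by (simp add: truncated_cubic_def)
qed

lemma truncated_cubic_eq_0:
  assumes "t > 0" "2 \<le> y * t"
  shows "truncated_cubic t y = 0"
proof -
  have "2/t \<le> y" using assms by (simp add: field_simps)
  with assms show ?thesis by (simp add: truncated_cubic_def)
qed

lemma truncated_cubic_bounds:
  assumes "t \<ge> 1"
  shows "0 \<le> truncated_cubic t y" "truncated_cubic t y \<le> 8"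
proof -
  define c where "c = max 0 (min y (2/t))"
  have c: "0 \<le> c" "c \<le> 2/t" using assms by (auto simp: c_def)
  have tc: "t * c \<le> 2" using c assms by (simp add: field_simps)
  have "2/t \<le> 2" using assms by (simp add: field_simps)
  then have c2: "c \<le> 2" using c by linarith
  have sq: "c\<^sup>2 \<le> 4" using c c2 power_mono[of c 2 2] by simp
  have "0 \<le> t * c" using assms c by simp
  then have "c\<^sup>2 * (2 - t*c) \<le> 4 * 2" using tc sq by (intro mult_mono) auto
  then show "truncated_cubic t y \<le> 8" by (simp add: truncated_cubic_def c_def)
  show "0 \<le> truncated_cubic t y" using tc by (simp add: truncated_cubic_def c_def)
qed

text \<open>Clamping to the interval from 0 to 2/t does not increase distances, so only the
  difference quotient of c^2 (2 - t c) on that interval matters. There c, d, t c and t d lie between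
  0 and 2, which places the quotient between -12 and 8.\<close>

lemma truncated_cubic_lipschitz:
  assumes "t \<ge> 1"
  shows "\<bar>truncated_cubic t x - truncated_cubic t y\<bar> \<le> 12 * \<bar>x - y\<bar>"
proof -
  define c where "c = max 0 (min x (2/t))"
  define d where "d = max 0 (min y (2/t))"
  have "2/t \<le> 2" using assms by (simp add: field_simps)
  have c': "0 \<le> c" "c \<le> 2/t" and d': "0 \<le> d" "d \<le> 2/t"
    using assms by (auto simp: c_def d_def)
  have c: "0 \<le> c" "t * c \<le> 2" "c \<le> 2" and d: "0 \<le> d" "t * d \<le> 2" "d \<le> 2"
    using order_trans[OF c'(2) \<open>2/t \<le> 2\<close>] order_trans[OF d'(2) \<open>2/t \<le> 2\<close>] c' d' assms
    by (simp_all add: field_simps)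
  have cd: "\<bar>c - d\<bar> \<le> \<bar>x - y\<bar>"
    using assms by (auto simp: c_def d_def min_def max_def abs_if)
  have eq: "c\<^sup>2 * (2 - t*c) - d\<^sup>2 * (2 - t*d) = (c - d) * (2 * (c+d) - (t*c)*c - (t*c)*d - (t*d)*d)"
    by (simp add: algebra_simps power2_eq_square)
  have m: "0 \<le> (t*c)*c" "(t*c)*c \<le> 2*2" "0 \<le> (t*c)*d" "(t*c)*d \<le> 2*2" "0 \<le> (t*d)*d" "(t*d)*d \<le> 2*2"
    using mult_mono[OF c(2) c(3)] mult_mono[OF c(2) d(3)] mult_mono[OF d(2) d(3)] c(1) d(1) assms by auto
  have "\<bar>2 * (c+d) - (t*c)*c - (t*c)*d - (t*d)*d\<bar> \<le> 12"
  proof -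
    define p q r where "p = (t*c)*c" and "q = (t*c)*d" and "r = (t*d)*d"
    have "0 \<le> p" "p \<le> 4" "0 \<le> q" "q \<le> 4" "0 \<le> r" "r \<le> 4" using m by (simp_all add: p_def q_def r_def)
    then have "\<bar>2 * (c + d) - p - q - r\<bar> \<le> 12" using c(1,3) d(1,3) by (simp add: abs_le_iff)
    then show ?thesis by (simp add: p_def q_def r_def)
  qed
  then have "\<bar>(c - d) * (2 * (c+d) - (t*c)*c - (t*c)*d - (t*d)*d)\<bar> \<le> \<bar>x - y\<bar> * 12"
    unfolding abs_mult using cd by (intro mult_mono) auto
  then show ?thesis unfolding truncated_cubic_def c_def[symmetric] d_def[symmetric] eq by simp
qed

lemma continuous_on_truncated_cubic [continuous_intros]:
  assumes "continuous_on S f" "continuous_on S g" "\<And>x. x \<in> S \<Longrightarrow> f x > 0"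
  shows "continuous_on S (\<lambda>x. truncated_cubic (f x) (g x))"
proof -
  have "\<forall>x\<in>S. f x \<noteq> 0" using assms(3) by force
  then show ?thesis unfolding truncated_cubic_def using assms(1,2) by (intro continuous_intros) auto
qed

text \<open>\<open>s\<^sup>2 * bowl_mean G s\<close> is the integral over t from 0 to s of t (t + 2)
  times the truncated cubic at 1 + t. Rescaling to the fixed interval \<open>{0..1}\<close> extracts
  the factor s^2, so that dividing the profile equation by s (s + 2) leaves nothing
  singular.\<close>

definition bowl_mean :: "(real \<Rightarrow> real) \<Rightarrow> real \<Rightarrow> real" where
  "bowl_mean G s = integral {0..1} (\<lambda>r. r * (s*r + 2) * truncated_cubic (1 + s*r) (G (s*r)))"

lemma continuous_on_bowl_mean_integrand:
  assumes "continuous_on {0..} G"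
  shows "continuous_on ({0..} \<times> {0..1})
    (\<lambda>(s,r). r * (s*r + 2) * truncated_cubic (1 + s*r) (G (s*r)))"
proof -
  have "continuous_on ({0..} \<times> {0..1}) (\<lambda>p :: real \<times> real. G (fst p * snd p))"
    by (rule continuous_on_compose2[OF assms]) (auto intro!: continuous_intros)
  then show ?thesis
    unfolding case_prod_beta
    by (intro continuous_intros) (auto intro!: add_pos_nonneg)
qed

lemma continuous_on_bowl_mean:
  assumes "continuous_on {0..} G"
  shows "continuous_on {0..} (bowl_mean G)"
  using integral_continuous_on_param[of "{0..}" 0 "1::real"
      "\<lambda>s r. r * (s*r + 2) * truncated_cubic (1 + s*r) (G (s*r))"]
    continuous_on_bowl_mean_integrand[OF assms]
  by (simp add: bowl_mean_def[abs_def])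

lemma bowl_mean_integrable:
  assumes "continuous_on {0..} G" "s \<ge> 0"
  shows "(\<lambda>r. r * (s*r + 2) * truncated_cubic (1 + s*r) (G (s*r))) integrable_on {0..1}"
proof (rule integrable_continuous_interval)
  have "continuous_on {0..1} ((\<lambda>(s,r). r * (s*r + 2) * truncated_cubic (1 + s*r) (G (s*r))) \<circ> (\<lambda>r. (s,r)))"
    using assms by (intro continuous_on_compose continuous_on_subset[OF continuous_on_bowl_mean_integrand])
      (auto intro!: continuous_intros)
  then show "continuous_on {0..1} (\<lambda>r. r * (s*r + 2) * truncated_cubic (1 + s*r) (G (s*r)))"
    by (simp add: o_def)
qed

lemma bowl_mean_bounds:
  assumes "continuous_on {0..} G" "s \<ge> 0"
  shows "0 \<le> bowl_mean G s" "bowl_mean G s \<le> 8 * (s + 2)"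
proof -
  note i = bowl_mean_integrable[OF assms]
  have p: "1 \<le> 1 + s*r" if "r \<in> {0..1}" for r using that assms by simp
  show "0 \<le> bowl_mean G s" unfolding bowl_mean_def
    using assms p by (intro integral_nonneg[OF i]) (auto intro!: mult_nonneg_nonneg truncated_cubic_bounds)
  have "bowl_mean G s \<le> integral {0..1} (\<lambda>r::real. 8 * (s+2))" unfolding bowl_mean_def
  proof (intro integral_le[OF i])
    fix r :: real assume r: "r \<in> {0..1}"
    have "s * r \<le> s" using r assms by (intro mult_left_le) auto
    moreover have "0 \<le> s * r" "r \<le> 1" using r assms by auto
    ultimately have "r * (s*r + 2) \<le> 1 * (s + 2)" by (intro mult_mono) linarith+
    then have "r * (s*r + 2) * truncated_cubic (1 + s*r) (G (s*r)) \<le> (1 * (s + 2)) * 8"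
      using assms p[OF r] by (rule_tac mult_mono) (auto intro: truncated_cubic_bounds)
    then show "r * (s*r + 2) * truncated_cubic (1 + s*r) (G (s*r)) \<le> 8 * (s+2)" by simp
  qed auto
  then show "bowl_mean G s \<le> 8 * (s + 2)" by simp
qed

text \<open>The contraction estimate. The Lipschitz constant 12 meets the weight
  \<open>exp (24 * t)\<close>, whose average over r is at most
  \<open>exp (24 * s) / (24 * s)\<close>; hence half of D survives, uniformly in s. The factor s on
  the left absorbs this 1/s, and s + 2 is the denominator of the fixed point equation.\<close>

lemma bowl_mean_diff:
  assumes "continuous_on {0..} G" "continuous_on {0..} H" "s \<ge> 0"
    and GH: "\<And>t. t \<ge> 0 \<Longrightarrow> \<bar>G t - H t\<bar> \<le> D * exp (24 * t)"
  shows "s * \<bar>bowl_mean G s - bowl_mean H s\<bar> \<le> (s + 2) * (D / 2) * exp (24 * s)"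
proof (cases "s = 0")
  case True
  have "0 \<le> D" using GH[of 0] by simp
  with True show ?thesis by simp
next
  case False
  then have s: "s > 0" using assms by simp
  have D: "0 \<le> D" using GH[of 0] by simp
  have e: "((\<lambda>r. 12 * (s+2) * D * exp (24 * s * r)) has_integral
     ((s+2) * D * exp (24 * s * 1) / (2 * s) - (s+2) * D * exp (24 * s * 0) / (2 * s))) {0..1}"
    using s by (intro fundamental_theorem_of_calculus)
      (auto intro!: derivative_eq_intros simp: has_real_derivative_iff_has_vector_derivative[symmetric])
  have diff: "bowl_mean G s - bowl_mean H s = integral {0..1}
      (\<lambda>r. r * (s*r + 2) * truncated_cubic (1 + s*r) (G (s*r)) - r * (s*r + 2) * truncated_cubic (1 + s*r) (H (s*r)))"
    unfolding bowl_mean_def using assms by (intro integral_diff[symmetric] bowl_mean_integrable)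
  have "\<bar>bowl_mean G s - bowl_mean H s\<bar> \<le> integral {0..1} (\<lambda>r. 12 * (s+2) * D * exp (24 * s * r))"
    unfolding diff real_norm_def[symmetric]
  proof (rule integral_norm_bound_integral)
    fix r :: real assume r: "r \<in> {0..1}"
    have "s * r \<le> s" using r s by (intro mult_left_le) auto
    moreover have "0 \<le> s * r" "r \<le> 1" using r s by auto
    ultimately have a: "r * (s*r + 2) \<le> 1 * (s + 2)" by (intro mult_mono) linarith+
    define q where "q = r * (s*r + 2)"
    have q: "0 \<le> q" "q \<le> s + 2" using a r s by (simp_all add: q_def)
    have "\<bar>truncated_cubic (1 + s*r) (G (s*r)) - truncated_cubic (1 + s*r) (H (s*r))\<bar> \<le> 12 * \<bar>G (s*r) - H (s*r)\<bar>"
      using r s by (intro truncated_cubic_lipschitz) auto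
    also have "\<dots> \<le> 12 * (D * exp (24 * (s*r)))" using GH[of "s*r"] r s by auto
    finally have "q * \<bar>truncated_cubic (1 + s*r) (G (s*r)) - truncated_cubic (1 + s*r) (H (s*r))\<bar>
        \<le> (s+2) * (12 * (D * exp (24 * (s*r))))"
      using q s by (intro mult_mono) auto
    moreover have "r * (s * r + 2) * truncated_cubic (1 + s * r) (G (s * r)) -
        r * (s * r + 2) * truncated_cubic (1 + s * r) (H (s * r)) = 
        q * (truncated_cubic (1 + s*r) (G (s*r)) - truncated_cubic (1 + s*r) (H (s*r)))"
      unfolding q_def by (rule right_diff_distrib[symmetric])
    moreover have "(s+2) * (12 * (D * exp (24 * (s*r)))) = 12 * (s + 2) * D * exp (24 * s * r)"
      by (simp only: mult_ac)
    ultimately show "norm (r * (s * r + 2) * truncated_cubic (1 + s * r) (G (s * r)) -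
               r * (s * r + 2) * truncated_cubic (1 + s * r) (H (s * r)))
         \<le> 12 * (s + 2) * D * exp (24 * s * r)"
      using q by (simp only: real_norm_def abs_mult abs_of_nonneg)
  next
    show "(\<lambda>x. x * (s * x + 2) * truncated_cubic (1 + s * x) (G (s * x)) - 
       x * (s * x + 2) * truncated_cubic (1 + s * x) (H (s * x))) integrable_on {0..1}"
      using assms by (intro integrable_diff bowl_mean_integrable)
    show "(\<lambda>r. 12 * (s + 2) * D * exp (24 * s * r)) integrable_on {0..1}"
      using e by blast
  qed
  also have "\<dots> = (s+2) * D * exp (24 * s * 1) / (2 * s) - (s+2) * D * exp (24 * s * 0) / (2 * s)"
    by (rule integral_unique[OF e])
  also have "\<dots> \<le> (s+2) * D * exp (24 * s) / (2 * s)" using s D by simp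
  finally have "s * \<bar>bowl_mean G s - bowl_mean H s\<bar> \<le> s * ((s+2) * D * exp (24 * s) / (2 * s))"
    using s by (intro mult_left_mono) auto
  also have "\<dots> = (s + 2) * (D / 2) * exp (24 * s)" using s by simp
  finally show ?thesis .
qed

text \<open>Banach's fixed point theorem in an exponentially weighted supremum norm, which yields
  the solution on the whole half line at once instead of by continuation.\<close>

lemma bowl_fixpoint_exists:
  "\<exists>G. continuous_on {0..} G \<and> (\<forall>s\<ge>0. G s = (2 + s * bowl_mean G s) / (s + 2))"
proof -
  \<comment> \<open>The unknown b is G divided by the weight. Continuing by \<open>max 0 s\<close>
    to negative s lets T act on bounded continuous functions on the whole line. The integral term
    grows at most linearly, so the weight also keeps T b bounded by 1.\<close>
  define wt where "wt b s = exp (24 * s) * apply_bcontfun b s" for b :: "real \<Rightarrow>\<^sub>C real" and s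
  define T where "T b s = exp (- 24 * max 0 s) * ((2 + max 0 s * bowl_mean (wt b) (max 0 s)) / (max 0 s + 2))"
    for b s
  have wt: "continuous_on {0..} (wt b)" for b
    unfolding wt_def by (intro continuous_intros continuous_on_apply_bcontfun)
  have "T b \<in> bcontfun" for b
  proof (rule bcontfun_normI)
    have "continuous_on UNIV (\<lambda>s. bowl_mean (wt b) (max 0 s))"
      by (rule continuous_on_compose2[OF continuous_on_bowl_mean[OF wt]]) (auto intro!: continuous_intros)
    moreover have "max 0 s + 2 \<noteq> 0" for s :: real by linarith
    ultimately show "continuous_on UNIV (T b)" unfolding T_def
      by (intro continuous_intros) auto
    fix s :: real
    define u where "u = max 0 s"
    have u: "u \<ge> 0" by (simp add: u_def)
    note m = bowl_mean_bounds[OF wt u, of b]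
    have "u * bowl_mean (wt b) u \<le> u * (8 * (u+2))" using m u by (intro mult_left_mono)
    then have "2 + u * bowl_mean (wt b) u \<le> (1 + 8*u) * (u+2)" using u by (simp add: algebra_simps)
    then have "(2 + u * bowl_mean (wt b) u) / (u + 2) \<le> 1 + 8*u"
      using u by (simp add: pos_divide_le_eq)
    also have "\<dots> \<le> exp (24 * u)" using exp_ge_add_one_self[of "24*u"] u by linarith
    finally have "exp (- 24 * u) * ((2 + u * bowl_mean (wt b) u) / (u + 2)) \<le> exp (-24*u) * exp (24*u)"
      by (intro mult_left_mono) auto
    also have "\<dots> = 1" by (simp add: exp_add[symmetric])
    finally show "norm (T b s) \<le> 1"
      unfolding T_def u_def[symmetric] using u m by simp
  qed
  then have TB: "apply_bcontfun (Bcontfun (T b)) = T b" for b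
    by (simp add: Bcontfun_inverse)
  have "\<exists>!b. Bcontfun (T b) = b"
  proof (rule banach_fix_type[of "1/2"]; (intro allI)?)
    fix b c :: "real \<Rightarrow>\<^sub>C real"
    have "dist (T b s) (T c s) \<le> 1/2 * dist b c" for s
    proof -
      define u where "u = max 0 s"
      have u: "u \<ge> 0" by (simp add: u_def)
      have "\<bar>wt b t - wt c t\<bar> \<le> dist b c * exp (24 * t)" for t
      proof -
        have "\<bar>wt b t - wt c t\<bar> = exp (24*t) * dist (apply_bcontfun b t) (apply_bcontfun c t)"
          by (simp add: wt_def dist_real_def right_diff_distrib[symmetric] abs_mult)
        also have "\<dots> \<le> exp (24*t) * dist b c" by (intro mult_left_mono dist_bounded) auto
        finally show ?thesis by (simp add: mult.commute)
      qed
      note this[THEN bowl_mean_diff[OF wt wt u]]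
      then have le: "u * \<bar>bowl_mean (wt b) u - bowl_mean (wt c) u\<bar> / (u+2) \<le> dist b c / 2 * exp (24*u)"
        using u by (simp add: field_simps)
      have "dist (T b s) (T c s) = exp (-24*u) * (u * \<bar>bowl_mean (wt b) u - bowl_mean (wt c) u\<bar> / (u+2))"
      proof -
        have "T b s - T c s = exp (-24*u) * (u * (bowl_mean (wt b) u - bowl_mean (wt c) u) / (u+2))"
          unfolding T_def u_def[symmetric] right_diff_distrib[symmetric] diff_divide_distrib[symmetric]
          by (simp add: right_diff_distrib)
        then show ?thesis using u by (simp add: dist_real_def abs_mult)
      qed
      also have "\<dots> \<le> exp (-24*u) * (dist b c / 2 * exp (24*u))"
        using le by (intro mult_left_mono) auto
      also have "\<dots> = dist b c / 2 * (exp (-24*u) * exp (24*u))" by (simp only: mult_ac)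
      also have "\<dots> = 1/2 * dist b c" by (simp add: exp_add[symmetric])
      finally show ?thesis .
    qed
    then show "dist (Bcontfun (T b)) (Bcontfun (T c)) \<le> 1/2 * dist b c"
      by (intro dist_bound) (simp add: TB)
  qed auto
  then obtain b where b: "Bcontfun (T b) = b" by blast
  have "wt b s = (2 + s * bowl_mean (wt b) s) / (s + 2)" if "s \<ge> 0" for s
  proof -
    have "wt b s = exp (24 * s) * T b s" using TB[of b] by (simp add: wt_def b)
    also have "\<dots> = exp (24 * s) * exp (-24 * s) * ((2 + s * bowl_mean (wt b) s) / (s + 2))"
      using that by (simp add: T_def max_def)
    also have "exp (24 * s) * exp (-24 * s) = 1" by (simp add: exp_add[symmetric])
    finally show ?thesis by simp
  qed
  with wt[of b] show ?thesis by blast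
qed

text \<open>Two points remain after the fixed point: the truncation is never active, and G(w - 1),
  continued by its value 1 to w < 1, is continuously differentiable across the singular point w = 1,
  because its derivative vanishes there.\<close>

lemma bowl_profile_exists:
  obtains g g' :: "real \<Rightarrow> real"
  where "\<And>w. (g has_real_derivative g' w) (at w)" "continuous_on UNIV g'"
    "\<And>w. w \<ge> 1 \<Longrightarrow> 0 \<le> g w" "\<And>w. w \<ge> 1 \<Longrightarrow> g w * w \<le> 2"
    "\<And>w. w \<ge> 1 \<Longrightarrow> (w\<^sup>2 - 1) * g' w = (2 - g w * w) * (1 + (g w)\<^sup>2 * (w\<^sup>2 - 1)) - g w * w"
proof -
  obtain G where G: "continuous_on {0..} G" and Geq: "\<And>s. s \<ge> 0 \<Longrightarrow> G s = (2 + s * bowl_mean G s) / (s + 2)"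
    using bowl_fixpoint_exists by blast
  define m where "m = bowl_mean G"
  have m: "continuous_on {0..} m" unfolding m_def by (rule continuous_on_bowl_mean[OF G])
  define h where "h t = t * (t+2) * truncated_cubic (1+t) (G t)" for t
  have h: "continuous_on {0..} h" unfolding h_def using G by (intro continuous_intros) auto
  have h0: "0 \<le> h t" if "t \<ge> 0" for t 
    using that by (auto simp: h_def intro!: mult_nonneg_nonneg truncated_cubic_bounds)
  define J where "J s = integral {0..s} h" for s
  have hi: "h integrable_on {a..b}" if "0 \<le> a" for a b
    using that by (intro integrable_continuous_interval continuous_on_subset[OF h]) auto
  have Jm: "J s = s\<^sup>2 * m s" if "s \<ge> 0" for s
  proof (cases "s = 0")
    case False
    then have s: "s > 0" using that by simp
    have "(h has_integral J s) {0..s}" unfolding J_def using hi[of 0 s] by (simp add: integrable_integral)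
    from has_integral_stretch_real[OF this, of s] s
    have "((\<lambda>x. h (s * x)) has_integral J s / s) {0..1}" by (simp add: image_divide_atLeastAtMost)
    then have "J s / s = integral {0..1} (\<lambda>x. h (s * x))" by (simp add: integral_unique)
    also have "(\<lambda>x. h (s * x)) = (\<lambda>x. s * (x * (s*x + 2) * truncated_cubic (1 + s*x) (G (s*x))))"
      by (simp add: h_def fun_eq_iff)
    also have "integral {0..1} \<dots> = s * m s" by (simp add: m_def bowl_mean_def)
    finally have "J s / s = s * m s" .
    then show ?thesis using s by (simp add: field_simps power2_eq_square)
  qed (simp add: J_def)
  have GJ: "(s\<^sup>2 + 2 * s) * G s = 2 * s + J s" if "s \<ge> 0" for s
  proof -
    have "(s + 2) * G s = 2 + s * m s" using Geq[OF that] that by (simp add: m_def)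
    then have "s * ((s + 2) * G s) = s * (2 + s * m s)" by simp
    then show ?thesis using that by (simp add: Jm algebra_simps power2_eq_square)
  qed
  have G0: "G 0 = 1" using Geq[of 0] by simp
  have Gpos: "0 \<le> G s" if "s \<ge> 0" for s
    using Geq[OF that] bowl_mean_bounds(1)[OF G that] that by simp
  \<comment> \<open>By \<open>GJ\<close>, for s > 0 the bound is equivalent to J s \<le> 2 s / (1 +
    s), whose right-hand side increases. After the last point r where the bound holds, the
    truncation would make h vanish, so J would stay constant and the bound could not be
    lost.\<close>
  have Gle: "G s * (1 + s) \<le> 2" if "s \<ge> 0" for s
  proof (rule ccontr)
    assume *: "\<not> G s * (1 + s) \<le> 2"
    have cont: "continuous_on {0..s} (\<lambda>t. G t * (1 + t))"
      using that by (intro continuous_intros continuous_on_subset[OF G]) auto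
    define K where "K = {t\<in>{0..s}. G t * (1+t) \<le> 2}"
    have K: "K = {0..s} \<inter> (\<lambda>t. G t * (1 + t)) -` {..2}" by (auto simp: K_def)
    have "compact K" unfolding compact_eq_bounded_closed
    proof
      show "closed K" 
        using continuous_closed_preimage[OF cont closed_atLeastAtMost closed_atMost] K by simp
      show "bounded K" by (rule bounded_subset[of "{0..s}"]) (auto simp: K)
    qed
    moreover have "0 \<in> K" using that G0 by (simp add: K_def)
    ultimately obtain r where r: "r \<in> K" "\<And>t. t \<in> K \<Longrightarrow> t \<le> r"
      using compact_attains_sup[of K] by blast
    have rs: "0 \<le> r" "r < s" using r * by (auto simp: K_def less_le)
    have big: "2 \<le> G t * (1+t)" if "r < t" "t \<le> s" for t
    proof (rule ccontr)
      assume "\<not> 2 \<le> G t * (1+t)"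
      then have "t \<in> K" using that rs by (simp add: K_def)
      then show False using r(2)[of t] that by simp
    qed
    have h_eq: "h t = 0" if "t \<in> {r<..s}" for t
      using big[of t] that rs by (simp add: h_def truncated_cubic_eq_0 add.commute)
    have "(h has_integral 0) {r..s}"
      by (rule has_integral_spike_finite[of "{r}" _ _ "\<lambda>_. 0"]) (simp_all add: h_eq)
    then have "integral {r..s} h = 0" by (rule integral_unique)
    then have "J s = J r"
      using Henstock_Kurzweil_Integration.integral_combine[of 0 r s h] hi[of 0 s] rs by (simp add: J_def)
    have "(r\<^sup>2 + 2 * r) * G r * (1 + r) \<le> (r\<^sup>2 + 2 * r) * 2"
      using r(1) rs unfolding mult.assoc by (intro mult_left_mono) (auto simp: K_def)
    then have "(2 * r + J r) * (1 + r) \<le> (r\<^sup>2 + 2 * r) * 2" using GJ[of r] rs by simp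
    then have "J r * (1 + r) \<le> 2 * r" by (simp add: algebra_simps power2_eq_square)
    then have "J s \<le> 2 * r / (1 + r)" using rs \<open>J s = J r\<close> by (simp add: field_simps)
    also have "\<dots> < 2 * s / (1 + s)" using rs by (simp add: field_simps)
    finally have "J s * (1 + s) < 2 * s" using rs by (simp add: field_simps)
    moreover have "(s\<^sup>2 + 2 * s) * 2 < (s\<^sup>2 + 2 * s) * (G s * (1 + s))"
      using * rs by (intro mult_strict_left_mono) (auto intro!: add_pos_pos)
    then have "(s\<^sup>2 + 2 * s) * 2 < (2 * s + J s) * (1 + s)" using GJ[of s] rs by (simp add: mult.assoc[symmetric])
    ultimately show False by (simp add: algebra_simps power2_eq_square)
  qed
  have heq: "h s = (s\<^sup>2 + 2 * s) * ((G s)\<^sup>2 * (2 - G s * (1+s)))" if "s \<ge> 0" for s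
    unfolding h_def using that Gpos[OF that] Gle[OF that]
    by (subst truncated_cubic_eq) (auto simp: algebra_simps power2_eq_square)
  \<comment> \<open>This value is what makes the derivative of G at 0 vanish: G s - 1 equals s (m s
    - 1) / (s + 2).\<close>
  have m0: "m 0 = 1"
  proof -
    have "((\<lambda>r::real. 2 * r) has_integral (1\<^sup>2 - 0\<^sup>2)) {0..1}"
      by (intro fundamental_theorem_of_calculus)
        (auto intro!: derivative_eq_intros simp: has_real_derivative_iff_has_vector_derivative[symmetric])
    then show ?thesis unfolding m_def bowl_mean_def
      by (simp add: G0 truncated_cubic_def integral_unique mult.commute)
  qed
  define g where "g w = G (max 0 (w - 1))" for w
  \<comment> \<open>The derivative of G, solved from the profile equation. The first summand is (2 -
    2 (1 + s) G s) / (s^2 + 2 s) with the common factor s cancelled, so that k is continuous at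
    0.\<close>
  define k where "k s = - 2 * (1 + m s + s * m s) / (s+2)\<^sup>2 + (G s)\<^sup>2 * (2 - G s * (1+s))" for s
  define g' where "g' w = k (max 0 (w - 1))" for w
  have k0: "k 0 = 0" by (simp add: k_def m0 G0)
  have keq: "(s\<^sup>2 + 2 * s) * k s = 2 + h s - 2 * (1+s) * G s" if "s \<ge> 0" for s
  proof -
    have "(s\<^sup>2 + 2 * s) * (- 2 * (1 + m s + s * m s) / (s+2)\<^sup>2) = 2 - 2 * (1+s) * ((2 + s * m s)/(s+2))"
    proof -
      have s2: "s + 2 \<noteq> 0" using that by simp
      have "s\<^sup>2 + 2 * s = s * (s+2)" by (simp add: power2_eq_square algebra_simps)
      then have "(s\<^sup>2 + 2 * s) * (- 2 * (1 + m s + s * m s) / (s+2)\<^sup>2) = s * (- 2 * (1 + m s + s * m s)) / (s+2)"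
        using s2 by (simp add: power2_eq_square)
      also have "s * (- 2 * (1 + m s + s * m s)) = 2 * (s+2) - 2 * (1+s) * (2 + s * m s)"
        by (simp add: algebra_simps)
      also have "\<dots> / (s+2) = 2 - 2 * (1+s) * ((2 + s * m s)/(s+2))"
        unfolding diff_divide_distrib nonzero_mult_div_cancel_right[OF s2] by simp
      finally show ?thesis .
    qed
    then show ?thesis 
      using Geq[OF that] by (simp add: k_def heq[OF that] distrib_left m_def)
  qed
  show thesis
  proof
    fix w :: real
    show "(g has_real_derivative g' w) (at w)"
    proof (cases w "1::real" rule: linorder_cases)
      case less
      have "((\<lambda>_. 1) has_real_derivative g' w) (at w)" using less by (simp add: g'_def k0)
      then show ?thesis
        by (rule has_field_derivative_transform_within_open[where S="{..<1}"])
          (use less in \<open>simp_all add: g_def G0\<close>)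
    next
      case equal
      \<comment> \<open>The slope function in Caratheodory's criterion at w = 1. On the left of 1 it
        is 0 since m 0 = 1, which agrees with the constant continuation.\<close>
      have "isCont (\<lambda>x. (m (max 0 (x - 1)) - 1) / (max 0 (x - 1) + 2)) 1"
      proof -
        have "continuous_on UNIV (\<lambda>x. m (max 0 (x - 1)))"
          by (rule continuous_on_compose2[OF m]) (auto intro!: continuous_intros)
        moreover have "max 0 (x - 1) + 2 \<noteq> 0" for x :: real by linarith
        ultimately have "continuous_on UNIV (\<lambda>x. (m (max 0 (x - 1)) - 1) / (max 0 (x - 1) + 2))"
          by (intro continuous_intros) auto
        then show ?thesis by (simp add: continuous_on_eq_continuous_at)
      qed
      moreover have "g x - g 1 = (m (max 0 (x - 1)) - 1) / (max 0 (x - 1) + 2) * (x - 1)" for x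
        using Geq[of "x - 1"] by (auto simp: g_def G0 m0 max_def m_def[symmetric] field_simps)
      ultimately show ?thesis
        unfolding equal CARAT_DERIV
        by (intro exI[of _ "\<lambda>x. (m (max 0 (x - 1)) - 1) / (max 0 (x - 1) + 2)"]) (auto simp: g'_def k0 m0)
    next
      case greater
      define s where "s = w - 1"
      have s: "s > 0" using greater by (simp add: s_def)
      have "(J has_real_derivative h s) (at s within {0..s+1})"
        unfolding J_def using s by (intro integral_has_real_derivative continuous_on_subset[OF h]) auto
      then have J: "(J has_real_derivative h s) (at s)"
        using s by (subst (asm) at_within_interior) auto
      have "((\<lambda>s. (2 * s + J s) / (s\<^sup>2 + 2 * s)) has_real_derivative k s) (at s)"
      proof -
        have q: "s\<^sup>2 + 2 * s > 0" using s by (simp add: add_pos_pos)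
        have "((\<lambda>s. (2 * s + J s) / (s\<^sup>2 + 2 * s)) has_real_derivative 
           ((2 + h s) * (s\<^sup>2 + 2 * s) - (2 * s + J s) * (2 * s + 2)) / ((s\<^sup>2 + 2 * s) * (s\<^sup>2 + 2 * s))) (at s)"
          using q by (auto intro!: derivative_eq_intros J)
        moreover have "((2 + h s) * (s\<^sup>2 + 2 * s) - (2 * s + J s) * (2 * s + 2)) 
            = (s\<^sup>2 + 2 * s) * ((s\<^sup>2 + 2 * s) * k s)"
        proof -
          have "2 * s + J s = (s\<^sup>2 + 2 * s) * G s" using GJ[of s] s by simp
          moreover have "(s\<^sup>2 + 2 * s) * k s = 2 + h s - 2 * (1+s) * G s" using keq[of s] s by simp
          ultimately show ?thesis by (simp only:) (simp add: algebra_simps)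
        qed
        ultimately show ?thesis using q by simp
      qed
      then have "(G has_real_derivative k s) (at s)"
      proof (rule has_field_derivative_transform_within_open[where S="{0<..}"])
        fix r :: real assume "r \<in> {0<..}"
        then have "r\<^sup>2 + 2 * r > 0" "r \<ge> 0" by (simp_all add: add_pos_pos)
        then show "(2 * r + J r) / (r\<^sup>2 + 2 * r) = G r" 
          using GJ[of r] by (simp add: divide_eq_eq mult.commute)
      qed (use s in auto)
      then have "((\<lambda>w. G (w - 1)) has_real_derivative k s) (at w)"
        unfolding s_def using DERIV_shift[of G "k (w-1)" w "-1"] by simp
      then have "((\<lambda>w. G (w - 1)) has_real_derivative g' w) (at w)" 
        using greater by (simp add: g'_def s_def)
      then show ?thesis
        by (rule has_field_derivative_transform_within_open[where S="{1<..}"])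
          (use greater in \<open>simp_all add: g_def\<close>)
    qed
  next
    have "continuous_on {0..} k" unfolding k_def using m G by (intro continuous_intros) auto
    then show "continuous_on UNIV g'" unfolding g'_def
      by (rule continuous_on_compose2) (auto intro!: continuous_intros)
  next
    fix w :: real assume w: "w \<ge> 1"
    define s where "s = w - 1"
    have s: "s \<ge> 0" "w = 1 + s" using w by (simp_all add: s_def)
    have gs: "g w = G s" "g' w = k s" using s by (simp_all add: g_def g'_def)
    show "0 \<le> g w" "g w * w \<le> 2" using Gpos Gle s gs by auto
    have rho: "w\<^sup>2 - 1 = s\<^sup>2 + 2 * s" by (simp add: s power2_eq_square algebra_simps)
    show "(w\<^sup>2 - 1) * g' w = (2 - g w * w) * (1 + (g w)\<^sup>2 * (w\<^sup>2 - 1)) - g w * w"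
      unfolding gs rho using keq[OF s(1)] heq[OF s(1)] by (simp add: s(2) algebra_simps)
  qed
qed

section \<open>Radial graphs in the hyperboloid model\<close>

lemma hpart_nth [simp]:
  "hpart x $ 1 = x$1" "hpart x $ 2 = x$2" "hpart x $ 3 = x$3" "hpart x $ 4 = 0"
  by (simp_all add: hpart_def vector_def)

lemma ez_nth [simp]: "ez $ 1 = 0" "ez $ 2 = 0" "ez $ 3 = 0" "ez $ 4 = 1"
  by (simp_all add: ez_def axis_def)

lemma mink_commute: "mink x y = mink y x"
  by (simp add: mink_def mult.commute)

lemma bilinear_mink: "bilinear mink"
  unfolding bilinear_def by (intro conjI allI linearI) (simp_all add: mink_def algebra_simps)

lemmas mink_linear [simp] =
  bilinear_ladd[OF bilinear_mink] bilinear_radd[OF bilinear_mink]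
  bilinear_lmul[OF bilinear_mink] bilinear_rmul[OF bilinear_mink]
  bilinear_lzero[OF bilinear_mink] bilinear_rzero[OF bilinear_mink]
  bilinear_lsub[OF bilinear_mink] bilinear_rsub[OF bilinear_mink]
  bilinear_lneg[OF bilinear_mink] bilinear_rneg[OF bilinear_mink]

lemma mink_ez [simp]: "mink x ez = x$4" "mink ez x = x$4"
  by (simp_all add: mink_def)

lemma mink_hpart_hpart: "mink (hpart x) (hpart y) = mink x (hpart y)"
  by (simp add: mink_def)

lemma mink_split: "mink x y = mink x (hpart y) + x$4 * y$4"
  by (simp add: mink_def)

lemma HxR_D:
  assumes "x \<in> HxR"
  shows "mink x (hpart x) = -1" "x$3 > 0"
  using assms by (simp_all add: HxR_def mink_def power2_eq_square)

lemma mink_eqI: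
  assumes "\<And>y. mink x y = mink x' y"
  shows "x = x'"
  using assms[of "axis 1 1"] assms[of "axis 2 1"] assms[of "axis 3 1"] assms[of "axis 4 1"]
  by (simp add: mink_def axis_def vec_eq_iff) (metis exhaust_4)

text \<open>Cauchy-Schwarz in the first two coordinates: tangency says x3 X3 = x1 X1 + x2 X2, and
  x3^2 exceeds x1^2 + x2^2. This is how the indefinite form becomes nonnegative on tangent
  vectors.\<close>

lemma tangent_hpart_nonneg:
  assumes x: "x \<in> HxR" and X: "mink X (hpart x) = 0"
  shows "0 \<le> mink X (hpart X)"
proof -
  have x3: "(x$3)\<^sup>2 = 1 + ((x$1)\<^sup>2 + (x$2)\<^sup>2)" using x by (simp add: HxR_def)
  have "x$3 * X$3 = x$1 * X$1 + x$2 * X$2" using X by (simp add: mink_def mult.commute)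
  then have "(x$3)\<^sup>2 * (X$3)\<^sup>2 = (x$1 * X$1 + x$2 * X$2)\<^sup>2" by (metis power_mult_distrib)
  also have "\<dots> \<le> ((x$1)\<^sup>2 + (x$2)\<^sup>2) * ((X$1)\<^sup>2 + (X$2)\<^sup>2)"
    using zero_le_power2[of "x$1 * X$2 - x$2 * X$1"] by (simp add: power2_eq_square algebra_simps)
  also have "\<dots> \<le> (x$3)\<^sup>2 * ((X$1)\<^sup>2 + (X$2)\<^sup>2)" unfolding x3
    by (intro mult_right_mono) auto
  finally have "(x$3)\<^sup>2 * (X$3)\<^sup>2 \<le> (x$3)\<^sup>2 * ((X$1)\<^sup>2 + (X$2)\<^sup>2)" .
  then have "(X$3)\<^sup>2 \<le> (X$1)\<^sup>2 + (X$2)\<^sup>2"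
    using HxR_D(2)[OF x] by simp
  then show ?thesis by (simp add: mink_def power2_eq_square)
qed

text \<open>The hyperbolic cosine of the distance of the projection of x to the point a.\<close>

definition hcosh :: "real^4 \<Rightarrow> real^4 \<Rightarrow> real" where
  "hcosh a x = - mink x a"

lemma hcosh_linear [simp]:
  "hcosh a (x + y) = hcosh a x + hcosh a y" "hcosh a (c *\<^sub>R x) = c * hcosh a x"
  by (simp_all add: hcosh_def)

lemma bounded_linear_hcosh: "bounded_linear (hcosh a)"
  by (intro linear_conv_bounded_linear[THEN iffD1] linearI) auto

lemma hcosh_hpart: "vaxis a \<Longrightarrow> hcosh a (hpart x) = hcosh a x"
  by (simp add: hcosh_def mink_def vaxis_def)

lemma vaxis_D:
  assumes "vaxis a"
  shows "a \<in> HxR" "hpart a = a" "a$4 = 0" "hcosh a a = 1" "hcosh a ez = 0"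
  using assms HxR_D[of a] 
  by (auto simp: vaxis_def hcosh_def hpart_def vec_eq_iff forall_4 vector_def mink_def)

text \<open>Cauchy-Schwarz for (1, x1, x2) and (1, a1, a2), whose Euclidean lengths are x3 and a3 by
  the equation of the hyperboloid.\<close>

lemma hcosh_ge_1:
  assumes "vaxis a" "x \<in> HxR"
  shows "1 \<le> hcosh a x"
proof -
  have a: "(a$3)\<^sup>2 = 1 + ((a$1)\<^sup>2 + (a$2)\<^sup>2)" "a$3 > 0" and x: "(x$3)\<^sup>2 = 1 + ((x$1)\<^sup>2 + (x$2)\<^sup>2)" "x$3 > 0"
    using assms by (simp_all add: vaxis_def HxR_def)
  have "(1 + (x$1 * a$1 + x$2 * a$2))\<^sup>2 \<le> (1 + ((x$1)\<^sup>2 + (x$2)\<^sup>2)) * (1 + ((a$1)\<^sup>2 + (a$2)\<^sup>2))"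
    using zero_le_power2[of "x$1 * a$2 - x$2 * a$1"] zero_le_power2[of "x$1 - a$1"] zero_le_power2[of "x$2 - a$2"]
    by (simp add: power2_eq_square algebra_simps)
  also have "\<dots> = (x$3 * a$3)\<^sup>2" by (simp add: a x power_mult_distrib)
  finally have "1 + (x$1 * a$1 + x$2 * a$2) \<le> x$3 * a$3"
    using a x by (rule_tac power2_le_imp_le) auto
  then show ?thesis using assms by (simp add: hcosh_def mink_def vaxis_def)
qed

text \<open>\<open>hcosh a x *\<^sub>R hpart x - a\<close> is the gradient of w on the hyperbolic
  plane, so this is the gradient of z - v(w) when v has slope p. It is normalised to height
  component 1 instead of length 1, which makes the soliton equation read "mean curvature equals
  1".\<close>

definition graph_normal :: "real^4 \<Rightarrow> real \<Rightarrow> real^4 \<Rightarrow> real^4" where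
  "graph_normal a p x = ez - p *\<^sub>R (hcosh a x *\<^sub>R hpart x - a)"

lemma mink_graph_normal:
  "mink y (graph_normal a p x) = y$4 - p * (hcosh a x * mink y (hpart x) + hcosh a y)"
  by (simp add: graph_normal_def hcosh_def)

lemma graph_normal_facts:
  assumes "vaxis a" "x \<in> HxR"
  shows "mink (graph_normal a p x) (hpart x) = 0"
    "graph_normal a p x $ 4 = 1"
    "mink (graph_normal a p x) (graph_normal a p x) = 1 + p\<^sup>2 * ((hcosh a x)\<^sup>2 - 1)"
    "1 \<le> 1 + p\<^sup>2 * ((hcosh a x)\<^sup>2 - 1)"
proof -
  note x = HxR_D[OF assms(2)] and a = vaxis_D[OF assms(1)]
  show z: "mink (graph_normal a p x) (hpart x) = 0"
    using hcosh_hpart[OF assms(1), of x]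
    by (simp add: graph_normal_def mink_hpart_hpart x mink_commute[of a] hcosh_def)
  show n4: "graph_normal a p x $ 4 = 1" by (simp add: graph_normal_def a)
  have "hcosh a (graph_normal a p x) = - p * ((hcosh a x)\<^sup>2 - 1)"
    using bounded_linear.linear[OF bounded_linear_hcosh[of a]]
    by (simp add: graph_normal_def linear_diff a hcosh_hpart[OF assms(1)] power2_eq_square)
  then show "mink (graph_normal a p x) (graph_normal a p x) = 1 + p\<^sup>2 * ((hcosh a x)\<^sup>2 - 1)"
    by (subst mink_graph_normal) (simp add: z n4 power2_eq_square)
  show "1 \<le> 1 + p\<^sup>2 * ((hcosh a x)\<^sup>2 - 1)"
    using hcosh_ge_1[OF assms] by simp
qed

text \<open>Pairing a vanishing combination with \<open>hpart x\<close> and n kills two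
  coefficients, and the Gram determinant kills those of X and Y; four independent vectors fill R^4.
  The frame replaces orthogonal decomposition, which an indefinite form does not provide
  automatically.\<close>

lemma adapted_frame_spans:
  assumes x: "x \<in> HxR"
    and perp: "mink X (hpart x) = 0" "mink Y (hpart x) = 0" "mink n (hpart x) = 0" "mink n X = 0" "mink n Y = 0"
    and n: "mink n n > 0"
    and gram: "mink X X * mink Y Y - (mink X Y)\<^sup>2 > 0"
  obtains k b c d where "y = k *\<^sub>R hpart x + b *\<^sub>R X + c *\<^sub>R Y + d *\<^sub>R n"
proof -
  define T :: "real^4 \<Rightarrow> real^4" where
    "T v = v$1 *\<^sub>R hpart x + v$2 *\<^sub>R X + v$3 *\<^sub>R Y + v$4 *\<^sub>R n" for v
  have lin: "linear T" by (rule linearI) (simp_all add: T_def algebra_simps)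
  have xx: "mink (hpart x) (hpart x) = -1" using HxR_D[OF x] by (simp add: mink_hpart_hpart)
  note perp' = perp perp[THEN trans[OF mink_commute]]
  have "v = 0" if v: "T v = 0" for v
  proof -
    have 1: "v$1 = 0" using arg_cong[OF v, of "\<lambda>z. mink z (hpart x)"] by (simp add: T_def xx perp')
    have 4: "v$4 = 0" using arg_cong[OF v, of "\<lambda>z. mink z n"] n by (simp add: T_def perp')
    have e: "v$2 * mink X X + v$3 * mink X Y = 0" "v$2 * mink X Y + v$3 * mink Y Y = 0"
      using arg_cong[OF v, of "\<lambda>z. mink z X"] arg_cong[OF v, of "\<lambda>z. mink z Y"]
      by (simp_all add: T_def perp' 1 4 mink_commute[of Y X])
    have "v$2 * (mink X X * mink Y Y - (mink X Y)\<^sup>2) = 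
        mink Y Y * (v$2 * mink X X + v$3 * mink X Y) - mink X Y * (v$2 * mink X Y + v$3 * mink Y Y)"
      by (simp add: algebra_simps power2_eq_square)
    moreover have "v$3 * (mink X X * mink Y Y - (mink X Y)\<^sup>2) = 
        mink X X * (v$2 * mink X Y + v$3 * mink Y Y) - mink X Y * (v$2 * mink X X + v$3 * mink X Y)"
      by (simp add: algebra_simps power2_eq_square)
    ultimately have "v$2 = 0" "v$3 = 0" using gram unfolding e by auto
    with 1 4 show ?thesis by (simp add: vec_eq_iff forall_4)
  qed
  then have "surj T" using lin linear_injective_imp_surjective linear_injective_0 by blast
  then obtain v where "y = T v" by (metis surjD)
  then show thesis by (intro that[of "v$1" "v$2" "v$3" "v$4"]) (simp add: T_def)
qed

lemma normal_unique:
  assumes "x \<in> HxR"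
    and "mink X (hpart x) = 0" "mink Y (hpart x) = 0" "mink n (hpart x) = 0" "mink n X = 0" "mink n Y = 0"
    and n: "mink n n > 0"
    and gram: "mink X X * mink Y Y - (mink X Y)\<^sup>2 > 0"
    and h: "mink \<eta> (hpart x) = 0" "mink \<eta> X = 0" "mink \<eta> Y = 0"
  obtains d where "\<eta> = d *\<^sub>R n"
proof -
  define \<zeta> where "\<zeta> = \<eta> - (mink \<eta> n / mink n n) *\<^sub>R n"
  have z: "mink \<zeta> (hpart x) = 0" "mink \<zeta> X = 0" "mink \<zeta> Y = 0" "mink \<zeta> n = 0"
    using assms by (simp_all add: \<zeta>_def)
  have "mink \<zeta> y = mink 0 y" for y
    by (rule adapted_frame_spans[OF assms(1-8), of y]) (simp add: z)
  then have "\<zeta> = 0" by (rule mink_eqI)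
  then show thesis using that by (simp add: \<zeta>_def)
qed

text \<open>Divided by the Gram determinant, the left side is the squared length of the covector
  (mink V X, mink V Y) in the inverse metric. It is applied to the gradient of w along the
  surface.\<close>

lemma tangent_parseval:
  assumes "x \<in> HxR"
    and p: "mink X (hpart x) = 0" "mink Y (hpart x) = 0" "mink n (hpart x) = 0" "mink n X = 0" "mink n Y = 0"
    and n: "mink n n > 0"
    and gram: "mink X X * mink Y Y - (mink X Y)\<^sup>2 > 0"
    and V: "mink V (hpart x) = 0" "mink V n = 0"
  shows "mink X X * (mink V Y)\<^sup>2 - 2 * mink X Y * mink V X * mink V Y + mink Y Y * (mink V X)\<^sup>2
    = (mink X X * mink Y Y - (mink X Y)\<^sup>2) * mink V V"
proof -
  note p' = p p[THEN trans[OF mink_commute]]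
  obtain k b c d where V': "V = k *\<^sub>R hpart x + b *\<^sub>R X + c *\<^sub>R Y + d *\<^sub>R n"
    by (rule adapted_frame_spans[OF assms(1-8)])
  have "mink (hpart x) (hpart x) = -1" using HxR_D[OF assms(1)] by (simp add: mink_hpart_hpart)
  then have "k = 0" "d = 0" using V n unfolding V' by (auto simp: p')
  then show ?thesis unfolding V'
    by (simp add: mink_commute[of Y X] power2_eq_square algebra_simps)
qed

section \<open>Mean curvature at a point of tangency with a radial graph\<close>

lemma mean_curv_scaleR:
  "mean_curv X Y XX XY YY (c *\<^sub>R n) = c * mean_curv X Y XX XY YY n"
  by (simp add: mean_curv_def Let_def algebra_simps add_divide_distrib diff_divide_distrib)

lemma mean_curv_graph_normal:
  fixes a x :: "real^4" and p v2 :: real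
  defines "w \<equiv> hcosh a x"
  assumes a: "vaxis a" and x: "x \<in> HxR"
    and gram: "mink X X * mink Y Y - (mink X Y)\<^sup>2 > 0"
    and tan: "mink X (hpart x) = 0" "mink Y (hpart x) = 0"
    and slope: "X$4 = p * hcosh a X" "Y$4 = p * hcosh a Y"
    and sec: "mink XX (hpart x) = - mink X (hpart X)" "mink XY (hpart x) = - mink X (hpart Y)"
      "mink YY (hpart x) = - mink Y (hpart Y)"
    and dev: "DXX = XX$4 - v2 * (hcosh a X)\<^sup>2 - p * hcosh a XX"
      "DXY = XY$4 - v2 * hcosh a X * hcosh a Y - p * hcosh a XY"
      "DYY = YY$4 - v2 * (hcosh a Y)\<^sup>2 - p * hcosh a YY"
  shows "2 * mean_curv X Y XX XY YY (graph_normal a p x) =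
    (mink X X * DYY - 2 * mink X Y * DXY + mink Y Y * DXX) / (mink X X * mink Y Y - (mink X Y)\<^sup>2)
    + (v2 - p^3 * w) * (w\<^sup>2 - 1) / (1 + p\<^sup>2 * (w\<^sup>2 - 1)) + 2 * p * w"
    and "mink (graph_normal a p x) X = 0" "mink (graph_normal a p x) Y = 0"
proof -
  define n where "n = graph_normal a p x"
  define W where "W = 1 + p\<^sup>2 * (w\<^sup>2 - 1)"
  note nf = graph_normal_facts[OF a x, of p, folded n_def w_def, folded W_def]
  have W: "W > 0" using nf(4) by simp
  have mn: "mink y n = y$4 - p * (w * mink y (hpart x) + hcosh a y)" for y
    unfolding n_def w_def by (rule mink_graph_normal)
  have nX: "mink n X = 0" and nY: "mink n Y = 0"
    using mn[of X] mn[of Y] by (simp_all add: tan slope mink_commute[of n])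
  then show "mink (graph_normal a p x) X = 0" "mink (graph_normal a p x) Y = 0" by (simp_all add: n_def)
  \<comment> \<open>The gradient of w on the hyperbolic plane, of squared length w^2 - 1.\<close>
  define Vh where "Vh = w *\<^sub>R hpart x - a"
  have Vy: "mink Vh y = hcosh a y" if "mink y (hpart x) = 0" for y
    using that by (simp add: Vh_def mink_commute[of _ y] hcosh_def)
  have Vx: "mink Vh (hpart x) = 0"
    using HxR_D[OF x] hcosh_hpart[OF a, of x] 
    by (simp add: Vh_def mink_hpart_hpart mink_commute[of a] w_def hcosh_def)
  have VV: "mink Vh Vh = w\<^sup>2 - 1"
  proof -
    have "mink Vh Vh = hcosh a Vh" using Vy Vx by simp
    also have "\<dots> = w * w - 1"
      using bounded_linear.linear[OF bounded_linear_hcosh[of a]] vaxis_D[OF a]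
      by (simp add: Vh_def linear_diff hcosh_hpart[OF a] w_def)
    finally show ?thesis by (simp add: power2_eq_square)
  qed
  have Vn: "mink Vh n = - p * (w\<^sup>2 - 1)"
    using mn[of Vh] Vx Vy[of Vh] VV vaxis_D[OF a] by (simp add: Vh_def)
  \<comment> \<open>Removing the normal component leaves the gradient of w along the
    surface.\<close>
  define V where "V = Vh - (mink Vh n / W) *\<^sub>R n"
  have V: "mink V X = hcosh a X" "mink V Y = hcosh a Y" "mink V (hpart x) = 0" "mink V n = 0"
    using W by (simp_all add: V_def nX nY nf Vx Vy tan)
  have "mink V V = mink Vh Vh - (mink Vh n)\<^sup>2 / W"
  proof -
    have "mink V V = mink V Vh" using V(4) by (subst (2) V_def) simp
    also have "\<dots> = mink Vh Vh - (mink Vh n / W) * mink Vh n"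
      by (simp add: V_def mink_commute[of n])
    finally show ?thesis by (simp add: power2_eq_square)
  qed
  also have "\<dots> = (w\<^sup>2 - 1) / W" unfolding VV Vn using W
    by (simp add: eq_divide_eq diff_divide_eq_iff) (simp add: W_def algebra_simps power2_eq_square)
  finally have VV': "mink V V = (w\<^sup>2 - 1) / W" .
  define E F G where "E = mink X X" and "F = mink X Y" and "G = mink Y Y"
  define x' y' where "x' = hcosh a X" and "y' = hcosh a Y"
  have gram': "E * G - F\<^sup>2 > 0" using gram by (simp add: E_def F_def G_def)
  have pars: "E * y'\<^sup>2 - 2 * F * x' * y' + G * x'\<^sup>2 = (E * G - F\<^sup>2) * ((w\<^sup>2 - 1) / W)"
    using tangent_parseval[OF x tan nf(1) nX nY _ gram V(3,4)] W
    unfolding VV' V nf E_def F_def G_def x'_def y'_def by simp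
  \<comment> \<open>The relations \<open>sec\<close> produce the horizontal metric only; subtracting
    the products of the heights, p^2 x' y' by \<open>slope\<close>, expresses it through E, F and
    G.\<close>
  have LL: "mink XX n = DXX + v2 * x'\<^sup>2 + p * w * (E - p\<^sup>2 * x'\<^sup>2)"
    "mink XY n = DXY + v2 * x' * y' + p * w * (F - p\<^sup>2 * x' * y')"
    "mink YY n = DYY + v2 * y'\<^sup>2 + p * w * (G - p\<^sup>2 * y'\<^sup>2)"
    unfolding mn sec dev E_def F_def G_def x'_def y'_def mink_split[of X X] mink_split[of X Y] mink_split[of Y Y] slope
    by (simp_all add: algebra_simps power2_eq_square)
  have half: "2 * (b / (2 * d)) = b / d" for b d :: real by simp
  have "E * mink YY n - 2 * F * mink XY n + G * mink XX n = 
      (E * DYY - 2 * F * DXY + G * DXX) + (v2 - p^3 * w) * (E * y'\<^sup>2 - 2 * F * x' * y' + G * x'\<^sup>2)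
      + 2 * p * w * (E * G - F\<^sup>2)"
    unfolding LL by (simp add: algebra_simps power2_eq_square power3_eq_cube)
  also have "\<dots> / (E * G - F\<^sup>2) = (E * DYY - 2 * F * DXY + G * DXX) / (E * G - F\<^sup>2) + 
      (v2 - p^3 * w) * (w\<^sup>2 - 1) / W + 2 * p * w"
    unfolding pars using gram' by (simp add: add_divide_distrib)
  finally show "2 * mean_curv X Y XX XY YY (graph_normal a p x) =
    (mink X X * DYY - 2 * mink X Y * DXY + mink Y Y * DXX) / (mink X X * mink Y Y - (mink X Y)\<^sup>2)
    + (v2 - p^3 * w) * (w\<^sup>2 - 1) / (1 + p\<^sup>2 * (w\<^sup>2 - 1)) + 2 * p * w"
    unfolding mean_curv_def Let_def n_def E_def F_def G_def W_def half by blast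
qed

section \<open>Derivatives along lines in a chart\<close>

text \<open>One partial derivative together with continuity of the other gives total
  differentiability. This passes from \<open>C2_param\<close>, which speaks of partial derivatives,
  to derivatives along oblique lines.\<close>

lemma partials_has_derivative:
  fixes f fs ft :: "real \<times> real \<Rightarrow> 'a::real_normed_vector"
  assumes "open U" "q \<in> U"
    and fs: "\<And>s t. (s,t) \<in> U \<Longrightarrow> ((\<lambda>s'. f (s',t)) has_vector_derivative fs (s,t)) (at s)"
    and ft: "\<And>s t. (s,t) \<in> U \<Longrightarrow> ((\<lambda>t'. f (s,t')) has_vector_derivative ft (s,t)) (at t)"
    and cont: "continuous_on U ft"
  shows "(f has_derivative (\<lambda>h. fst h *\<^sub>R fs q + snd h *\<^sub>R ft q)) (at q)"
proof -
  define s t where "s = fst q" and "t = snd q"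
  have q: "q = (s,t)" by (simp add: s_def t_def)
  obtain A B where AB': "open A" "open B" "q \<in> A \<times> B" "A \<times> B \<subseteq> U"
    by (rule open_prod_elim[OF assms(1,2)])
  have AB: "open A" "open B" "s \<in> A" "t \<in> B" "A \<times> B \<subseteq> U" using AB' q by auto
  \<comment> \<open>A ball is chosen in the second variable because the mean value argument there
    requires a convex set.\<close>
  obtain e where e: "e > 0" "ball t e \<subseteq> B" using openE[OF AB(2,4)] by blast
  have sub: "A \<times> ball t e \<subseteq> U" using AB e by blast
  have inAB: "q \<in> A \<times> ball t e" using q AB e by simp
  have op: "open (A \<times> ball t e)" using AB by (simp add: open_Times)
  have "((\<lambda>(x,y). f (x,y)) has_derivative (\<lambda>(tx,ty). tx *\<^sub>R fs q + blinfun_scaleR_left (ft (s,t)) ty))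
    (at (s,t) within A \<times> ball t e)"
  proof (rule has_derivative_partialsI[where f="\<lambda>x y. f (x,y)" and fy="\<lambda>x y. blinfun_scaleR_left (ft (x,y))"])
    show "((\<lambda>x. f (x, t)) has_derivative (\<lambda>tx. tx *\<^sub>R fs q)) (at s within A)"
      using fs[of s t] assms(2) q by (simp add: has_vector_derivative_def has_derivative_at_withinI)
    show "((\<lambda>y. f (x, y)) has_derivative blinfun_apply (blinfun_scaleR_left (ft (x, y)))) (at y within ball t e)"
      if "x \<in> A" "y \<in> ball t e" for x y
    proof -
      have "(x,y) \<in> U" using sub that by blast
      then show ?thesis using ft[of x y] 
        by (simp add: has_vector_derivative_def has_derivative_at_withinI)
    qed
    have "continuous (at (s,t) within A \<times> ball t e) ft"
      using continuous_on_subset[OF cont sub] inAB q by (simp add: continuous_on_eq_continuous_within)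
    from bounded_linear.continuous[OF bounded_linear_blinfun_scaleR_left this]
    show "continuous (at (s,t) within A \<times> ball t e) (\<lambda>(x, y). blinfun_scaleR_left (ft (x, y)))"
      by (simp add: case_prod_beta')
  qed (use e in auto)
  moreover have "at (s,t) within A \<times> ball t e = at q" using at_within_open[OF inAB op] q by simp
  ultimately show ?thesis using q by (simp add: case_prod_beta')
qed

lemma partials_line_derivative:
  fixes f fs ft :: "real \<times> real \<Rightarrow> 'a::real_normed_vector"
  assumes "open U" "q + r *\<^sub>R h \<in> U"
    and fs: "\<And>s t. (s,t) \<in> U \<Longrightarrow> ((\<lambda>s'. f (s',t)) has_vector_derivative fs (s,t)) (at s)"
    and ft: "\<And>s t. (s,t) \<in> U \<Longrightarrow> ((\<lambda>t'. f (s,t')) has_vector_derivative ft (s,t)) (at t)"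
    and cont: "continuous_on U ft"
  shows "((\<lambda>r. f (q + r *\<^sub>R h)) has_vector_derivative
      fst h *\<^sub>R fs (q + r *\<^sub>R h) + snd h *\<^sub>R ft (q + r *\<^sub>R h)) (at r)"
proof -
  have "((\<lambda>r. q + r *\<^sub>R h) has_derivative (\<lambda>x. x *\<^sub>R h)) (at r)"
    by (auto intro!: derivative_eq_intros)
  from has_derivative_compose[OF this partials_has_derivative[OF assms]]
  show ?thesis by (simp add: has_vector_derivative_def scaleR_add_right)
qed

lemma add_zero_pair [simp]: "q + (0, 0) = (q :: 'a::monoid_add \<times> 'b::monoid_add)"
  by (simp flip: zero_prod_def)

text \<open>Restricting a chart to lines reduces first and second order conditions on the surface to
  one-variable calculus; suitable directions (b, c) recover all second derivatives.\<close>

lemma C2_param_line: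
  assumes C2: "C2_param U \<phi> \<phi>u \<phi>v \<phi>uu \<phi>uv \<phi>vv" and q: "q \<in> U"
  obtains e where "e > 0" "\<And>r. \<bar>r\<bar> < e \<Longrightarrow> q + r *\<^sub>R (b,c) \<in> U"
    "\<And>r. \<bar>r\<bar> < e \<Longrightarrow> ((\<lambda>r. \<phi> (q + r *\<^sub>R (b,c))) has_vector_derivative
       b *\<^sub>R \<phi>u (q + r *\<^sub>R (b,c)) + c *\<^sub>R \<phi>v (q + r *\<^sub>R (b,c))) (at r)"
    "((\<lambda>r. b *\<^sub>R \<phi>u (q + r *\<^sub>R (b,c)) + c *\<^sub>R \<phi>v (q + r *\<^sub>R (b,c))) has_vector_derivative
       b\<^sup>2 *\<^sub>R \<phi>uu q + (2 * b * c) *\<^sub>R \<phi>uv q + c\<^sup>2 *\<^sub>R \<phi>vv q) (at 0)"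
proof -
  have U: "open U" and
    d: "\<And>s t. (s,t) \<in> U \<Longrightarrow> ((\<lambda>s'. \<phi> (s',t)) has_vector_derivative \<phi>u (s,t)) (at s)"
    "\<And>s t. (s,t) \<in> U \<Longrightarrow> ((\<lambda>t'. \<phi> (s,t')) has_vector_derivative \<phi>v (s,t)) (at t)"
    "\<And>s t. (s,t) \<in> U \<Longrightarrow> ((\<lambda>s'. \<phi>u (s',t)) has_vector_derivative \<phi>uu (s,t)) (at s)"
    "\<And>s t. (s,t) \<in> U \<Longrightarrow> ((\<lambda>t'. \<phi>u (s,t')) has_vector_derivative \<phi>uv (s,t)) (at t)"
    "\<And>s t. (s,t) \<in> U \<Longrightarrow> ((\<lambda>s'. \<phi>v (s',t)) has_vector_derivative \<phi>uv (s,t)) (at s)"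
    "\<And>s t. (s,t) \<in> U \<Longrightarrow> ((\<lambda>t'. \<phi>v (s,t')) has_vector_derivative \<phi>vv (s,t)) (at t)"
    and cont: "continuous_on U \<phi>v" "continuous_on U \<phi>uv" "continuous_on U \<phi>vv"
    using C2 by (auto simp: C2_param_def)
  have "open ((\<lambda>r. q + r *\<^sub>R (b,c)) -` U)"
    by (intro open_vimage U continuous_intros)
  moreover have "0 \<in> (\<lambda>r. q + r *\<^sub>R (b,c)) -` U" using q by simp
  ultimately obtain e where e: "e > 0" "ball 0 e \<subseteq> (\<lambda>r. q + r *\<^sub>R (b,c)) -` U" using openE by blast
  show thesis
  proof
    show "e > 0" by fact
    show in_U: "q + r *\<^sub>R (b,c) \<in> U" if "\<bar>r\<bar> < e" for r using e that by (auto simp: dist_real_def)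
    show "((\<lambda>r. \<phi> (q + r *\<^sub>R (b,c))) has_vector_derivative
       b *\<^sub>R \<phi>u (q + r *\<^sub>R (b,c)) + c *\<^sub>R \<phi>v (q + r *\<^sub>R (b,c))) (at r)" if "\<bar>r\<bar> < e" for r
      using partials_line_derivative[OF U in_U[OF that] d(1,2) cont(1)] by simp
    have "((\<lambda>r. b *\<^sub>R \<phi>u (q + r *\<^sub>R (b,c)) + c *\<^sub>R \<phi>v (q + r *\<^sub>R (b,c))) has_vector_derivative
       b *\<^sub>R (b *\<^sub>R \<phi>uu q + c *\<^sub>R \<phi>uv q) + c *\<^sub>R (b *\<^sub>R \<phi>uv q + c *\<^sub>R \<phi>vv q)) (at 0)"
      using partials_line_derivative[OF U in_U[of 0] d(3,4) cont(2)] 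
        partials_line_derivative[OF U in_U[of 0] d(5,6) cont(3)] e(1)
      by (intro has_vector_derivative_add bounded_linear.has_vector_derivative[OF bounded_linear_scaleR_right]) auto
    moreover have "b *\<^sub>R (b *\<^sub>R \<phi>uu q + c *\<^sub>R \<phi>uv q) + c *\<^sub>R (b *\<^sub>R \<phi>uv q + c *\<^sub>R \<phi>vv q) =
       b\<^sup>2 *\<^sub>R \<phi>uu q + (2 * b * c) *\<^sub>R \<phi>uv q + c\<^sup>2 *\<^sub>R \<phi>vv q"
      by (simp add: vec_eq_iff power2_eq_square algebra_simps)
    ultimately show "((\<lambda>r. b *\<^sub>R \<phi>u (q + r *\<^sub>R (b,c)) + c *\<^sub>R \<phi>v (q + r *\<^sub>R (b,c))) has_vector_derivative
       b\<^sup>2 *\<^sub>R \<phi>uu q + (2 * b * c) *\<^sub>R \<phi>uv q + c\<^sup>2 *\<^sub>R \<phi>vv q) (at 0)"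
      by simp
  qed
qed

lemma bounded_linear_hpart: "bounded_linear hpart"
  by (intro linear_conv_bounded_linear[THEN iffD1] linearI) (auto simp: vec_eq_iff forall_4)

lemma bounded_bilinear_mink: "bounded_bilinear mink"
  using bilinear_mink by (simp add: bilinear_conv_bounded_bilinear)

lemma deriv_eq_of_const:
  fixes k :: "real \<Rightarrow> real"
  assumes "(k has_real_derivative d) (at x)" "e > 0" "\<And>r. \<bar>r - x\<bar> < e \<Longrightarrow> k r = c"
  shows "d = 0"
proof -
  have "(k has_real_derivative 0) (at x)"
    by (rule has_field_derivative_transform_within_open[where S="ball x e" and f="\<lambda>_. c"])
      (use assms in \<open>auto simp: dist_real_def abs_minus_commute\<close>)
  then show ?thesis using assms(1) DERIV_unique by blast
qed

text \<open>Both identities come from differentiating the constraint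
  \<open>mink (y r) (hpart (y r)) = -1\<close>, once and twice.\<close>

lemma curve_in_HxR:
  assumes e: "e > 0" and y: "\<And>r. \<bar>r\<bar> < e \<Longrightarrow> (y has_vector_derivative y1 r) (at r)"
    and y1: "(y1 has_vector_derivative y2) (at 0)" and H: "\<And>r. \<bar>r\<bar> < e \<Longrightarrow> y r \<in> HxR"
  shows "mink (y1 0) (hpart (y 0)) = 0" "mink y2 (hpart (y 0)) = - mink (y1 0) (hpart (y1 0))"
proof -
  have hp: "((\<lambda>r. hpart (y r)) has_vector_derivative hpart (y1 r)) (at r)" if "\<bar>r\<bar> < e" for r
    using bounded_linear.has_vector_derivative[OF bounded_linear_hpart y[OF that]] .
  have sym: "mink u (hpart v) = mink v (hpart u)" for u v by (simp add: mink_def mult.commute)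
  have z: "mink (y1 r) (hpart (y r)) = 0" if r: "\<bar>r\<bar> < e" for r
  proof -
    have "((\<lambda>r. mink (y r) (hpart (y r))) has_real_derivative 
        mink (y r) (hpart (y1 r)) + mink (y1 r) (hpart (y r))) (at r)"
      using bounded_bilinear.has_vector_derivative[OF bounded_bilinear_mink y[OF r] hp[OF r]]
      by (simp add: has_real_derivative_iff_has_vector_derivative)
    from deriv_eq_of_const[OF this, of "e - \<bar>r\<bar>" "-1"] r
    have "mink (y r) (hpart (y1 r)) + mink (y1 r) (hpart (y r)) = 0"
      using H HxR_D by force
    then show ?thesis by (simp add: sym[of "y r"])
  qed
  show "mink (y1 0) (hpart (y 0)) = 0" using z[of 0] e by simp
  have "((\<lambda>r. mink (y1 r) (hpart (y r))) has_real_derivative 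
        mink (y1 0) (hpart (y1 0)) + mink y2 (hpart (y 0))) (at 0)"
    using bounded_bilinear.has_vector_derivative[OF bounded_bilinear_mink y1 hp[of 0]] e
    by (simp add: has_real_derivative_iff_has_vector_derivative)
  from deriv_eq_of_const[OF this e, of 0] z
  show "mink y2 (hpart (y 0)) = - mink (y1 0) (hpart (y1 0))" by simp
qed

section \<open>Second order conditions at a maximum\<close>

lemma second_derivative_test:
  fixes k k1 :: "real \<Rightarrow> real"
  assumes e: "e > 0" and k: "\<And>r. \<bar>r\<bar> < e \<Longrightarrow> (k has_real_derivative k1 r) (at r)"
    and k1: "(k1 has_real_derivative d) (at 0)" and max: "\<And>r. \<bar>r\<bar> < e \<Longrightarrow> k r \<le> k 0"
  shows "k1 0 = 0" "d \<le> 0"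
proof -
  show z: "k1 0 = 0"
    using DERIV_local_max[OF k[of 0] e] max e by simp
  show "d \<le> 0"
  proof (rule ccontr)
    assume "\<not> d \<le> 0"
    then have "d > 0" by simp
    from DERIV_pos_inc_right[OF k1 this]
    obtain \<delta> where \<delta>: "\<delta> > 0" "\<And>h. 0 < h \<Longrightarrow> h < \<delta> \<Longrightarrow> k1 0 < k1 (0 + h)" by blast
    define h where "h = min e \<delta> / 2"
    have h: "0 < h" "h < e" "h < \<delta>" using e \<delta> by (auto simp: h_def)
    have "k 0 < k h"
    proof (rule DERIV_pos_imp_increasing_open[OF h(1)])
      fix x assume x: "0 < x" "x < h"
      then show "\<exists>y. (k has_real_derivative y) (at x) \<and> y > 0"
        using k[of x] \<delta>(2)[of x] h z by (intro exI[of _ "k1 x"]) auto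
    next
      show "continuous_on {0..h} k"
      proof (rule DERIV_continuous_on)
        fix x assume "x \<in> {0..h}"
        then show "(k has_real_derivative k1 x) (at x within {0..h})"
          using h by (intro has_field_derivative_at_within[OF k]) simp
      qed
    qed
    then show False using max[of h] h by simp
  qed
qed

text \<open>The sign of \<sigma> decides between a maximum and a minimum of z - v(w), so that upper
  and lower barriers share all later statements.\<close>

lemma curve_height_max:
  fixes v v1 v2 :: "real \<Rightarrow> real"
  assumes e: "e > 0" and y: "\<And>r. \<bar>r\<bar> < e \<Longrightarrow> (y has_vector_derivative y1 r) (at r)"
    and y1: "(y1 has_vector_derivative y2) (at 0)"
    and v: "\<And>w. (v has_real_derivative v1 w) (at w)" "\<And>w. (v1 has_real_derivative v2 w) (at w)"
    and max: "\<And>r. \<bar>r\<bar> < e \<Longrightarrow> \<sigma> * (y r $ 4 - v (hcosh a (y r))) \<le> \<sigma> * (y 0 $ 4 - v (hcosh a (y 0)))"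
    and \<sigma>: "\<sigma> \<noteq> 0"
  shows "y1 0 $ 4 = v1 (hcosh a (y 0)) * hcosh a (y1 0)"
    "\<sigma> * (y2 $ 4 - v2 (hcosh a (y 0)) * (hcosh a (y1 0))\<^sup>2 - v1 (hcosh a (y 0)) * hcosh a y2) \<le> 0"
proof -
  have D4: "((\<lambda>r. z r $ 4) has_real_derivative z' $ 4) (at r)" if "(z has_vector_derivative z') (at r)" 
    for z :: "real \<Rightarrow> real^4" and z' r
    using bounded_linear.has_vector_derivative[OF bounded_linear_vec_nth that]
    by (simp add: has_real_derivative_iff_has_vector_derivative)
  have Dh: "((\<lambda>r. hcosh a (z r)) has_real_derivative hcosh a z') (at r)" if "(z has_vector_derivative z') (at r)" 
    for z z' r
    using bounded_linear.has_vector_derivative[OF bounded_linear_hcosh that]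
    by (simp add: has_real_derivative_iff_has_vector_derivative)
  define k where "k r = \<sigma> * (y r $ 4 - v (hcosh a (y r)))" for r
  define k1 where "k1 r = \<sigma> * (y1 r $ 4 - v1 (hcosh a (y r)) * hcosh a (y1 r))" for r
  have 1: "(k has_real_derivative k1 r) (at r)" if r: "\<bar>r\<bar> < e" for r
    unfolding k_def k1_def
    by (intro DERIV_cmult DERIV_diff D4 DERIV_chain2[OF v(1)] Dh y r)
  have y0: "(y has_vector_derivative y1 0) (at 0)" using y e by simp
  have "(k1 has_real_derivative \<sigma> * (y2 $ 4 - (v2 (hcosh a (y 0)) * hcosh a (y1 0) * hcosh a (y1 0) 
        + hcosh a y2 * v1 (hcosh a (y 0))))) (at 0)"
    unfolding k1_def
    by (intro DERIV_cmult DERIV_diff D4 DERIV_mult DERIV_chain2[OF v(2)] Dh y1 y0)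
  note st = second_derivative_test[OF e 1 this max[folded k_def]]
  show "y1 0 $ 4 = v1 (hcosh a (y 0)) * hcosh a (y1 0)"
    using st(1) \<sigma> by (simp add: k1_def)
  show "\<sigma> * (y2 $ 4 - v2 (hcosh a (y 0)) * (hcosh a (y1 0))\<^sup>2 - v1 (hcosh a (y 0)) * hcosh a y2) \<le> 0"
    using st(2) by (simp add: power2_eq_square algebra_simps)
qed

text \<open>The directions (1,0) and (0,1) give the pure identities; the mixed one follows from
  (1,1) by polarisation.\<close>

lemma chart_tangency:
  assumes C2: "C2_param U \<phi> \<phi>u \<phi>v \<phi>uu \<phi>uv \<phi>vv" and im: "\<phi> ` U \<subseteq> HxR" and q: "q \<in> U"
  shows "mink (\<phi>u q) (hpart (\<phi> q)) = 0" "mink (\<phi>v q) (hpart (\<phi> q)) = 0"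
    "mink (\<phi>uu q) (hpart (\<phi> q)) = - mink (\<phi>u q) (hpart (\<phi>u q))"
    "mink (\<phi>uv q) (hpart (\<phi> q)) = - mink (\<phi>u q) (hpart (\<phi>v q))"
    "mink (\<phi>vv q) (hpart (\<phi> q)) = - mink (\<phi>v q) (hpart (\<phi>v q))"
proof -
  have *: "mink (b *\<^sub>R \<phi>u q + c *\<^sub>R \<phi>v q) (hpart (\<phi> q)) = 0 \<and>
      mink (b\<^sup>2 *\<^sub>R \<phi>uu q + (2 * b * c) *\<^sub>R \<phi>uv q + c\<^sup>2 *\<^sub>R \<phi>vv q) (hpart (\<phi> q)) =
      - mink (b *\<^sub>R \<phi>u q + c *\<^sub>R \<phi>v q) (hpart (b *\<^sub>R \<phi>u q + c *\<^sub>R \<phi>v q))" for b c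
  proof -
    obtain e where e: "e > 0" "\<And>r. \<bar>r\<bar> < e \<Longrightarrow> q + r *\<^sub>R (b,c) \<in> U"
      "\<And>r. \<bar>r\<bar> < e \<Longrightarrow> ((\<lambda>r. \<phi> (q + r *\<^sub>R (b,c))) has_vector_derivative
         b *\<^sub>R \<phi>u (q + r *\<^sub>R (b,c)) + c *\<^sub>R \<phi>v (q + r *\<^sub>R (b,c))) (at r)"
      "((\<lambda>r. b *\<^sub>R \<phi>u (q + r *\<^sub>R (b,c)) + c *\<^sub>R \<phi>v (q + r *\<^sub>R (b,c))) has_vector_derivative
         b\<^sup>2 *\<^sub>R \<phi>uu q + (2 * b * c) *\<^sub>R \<phi>uv q + c\<^sup>2 *\<^sub>R \<phi>vv q) (at 0)"
      by (rule C2_param_line[OF C2 q, of b c]) (rule that)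
    have "\<phi> (q + r *\<^sub>R (b,c)) \<in> HxR" if "\<bar>r\<bar> < e" for r using e(2)[OF that] im by blast
    from curve_in_HxR[OF e(1,3,4) this] show ?thesis by simp
  qed
  have hp: "hpart (u + v) = hpart u + hpart v" for u v 
    using bounded_linear.linear[OF bounded_linear_hpart] by (rule linear_add)
  have sym: "mink u (hpart v) = mink v (hpart u)" for u v by (simp add: mink_def mult.commute)
  show 1: "mink (\<phi>u q) (hpart (\<phi> q)) = 0" "mink (\<phi>v q) (hpart (\<phi> q)) = 0"
    "mink (\<phi>uu q) (hpart (\<phi> q)) = - mink (\<phi>u q) (hpart (\<phi>u q))"
    "mink (\<phi>vv q) (hpart (\<phi> q)) = - mink (\<phi>v q) (hpart (\<phi>v q))"
    using *[of 1 0] *[of 0 1] by simp_all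
  show "mink (\<phi>uv q) (hpart (\<phi> q)) = - mink (\<phi>u q) (hpart (\<phi>v q))"
    using *[of 1 1] by (simp add: 1 hp sym[of "\<phi>v q" "\<phi>u q"])
qed

lemma chart_height_max:
  fixes v v1 v2 :: "real \<Rightarrow> real"
  assumes C2: "C2_param U \<phi> \<phi>u \<phi>v \<phi>uu \<phi>uv \<phi>vv" and q: "q \<in> U"
    and v: "\<And>w. (v has_real_derivative v1 w) (at w)" "\<And>w. (v1 has_real_derivative v2 w) (at w)"
    and max: "\<And>r. r \<in> U \<Longrightarrow> \<sigma> * (\<phi> r $ 4 - v (hcosh a (\<phi> r))) \<le> \<sigma> * (\<phi> q $ 4 - v (hcosh a (\<phi> q)))"
    and \<sigma>: "\<sigma> \<noteq> 0"
  defines "w \<equiv> hcosh a (\<phi> q)"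
  defines "x' \<equiv> hcosh a (\<phi>u q)" and "y' \<equiv> hcosh a (\<phi>v q)"
  shows "\<phi>u q $ 4 = v1 w * x'" "\<phi>v q $ 4 = v1 w * y'"
    "\<sigma> * (b\<^sup>2 * (\<phi>uu q $ 4 - v2 w * x'\<^sup>2 - v1 w * hcosh a (\<phi>uu q))
      + 2 * b * c * (\<phi>uv q $ 4 - v2 w * x' * y' - v1 w * hcosh a (\<phi>uv q))
      + c\<^sup>2 * (\<phi>vv q $ 4 - v2 w * y'\<^sup>2 - v1 w * hcosh a (\<phi>vv q))) \<le> 0"
proof -
  have *: "(b *\<^sub>R \<phi>u q + c *\<^sub>R \<phi>v q) $ 4 = v1 w * hcosh a (b *\<^sub>R \<phi>u q + c *\<^sub>R \<phi>v q) \<and>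
    \<sigma> * ((b\<^sup>2 *\<^sub>R \<phi>uu q + (2 * b * c) *\<^sub>R \<phi>uv q + c\<^sup>2 *\<^sub>R \<phi>vv q) $ 4
      - v2 w * (hcosh a (b *\<^sub>R \<phi>u q + c *\<^sub>R \<phi>v q))\<^sup>2
      - v1 w * hcosh a (b\<^sup>2 *\<^sub>R \<phi>uu q + (2 * b * c) *\<^sub>R \<phi>uv q + c\<^sup>2 *\<^sub>R \<phi>vv q)) \<le> 0" for b c
  proof -
    obtain e where e: "e > 0" "\<And>r. \<bar>r\<bar> < e \<Longrightarrow> q + r *\<^sub>R (b,c) \<in> U"
      "\<And>r. \<bar>r\<bar> < e \<Longrightarrow> ((\<lambda>r. \<phi> (q + r *\<^sub>R (b,c))) has_vector_derivative
         b *\<^sub>R \<phi>u (q + r *\<^sub>R (b,c)) + c *\<^sub>R \<phi>v (q + r *\<^sub>R (b,c))) (at r)"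
      "((\<lambda>r. b *\<^sub>R \<phi>u (q + r *\<^sub>R (b,c)) + c *\<^sub>R \<phi>v (q + r *\<^sub>R (b,c))) has_vector_derivative
         b\<^sup>2 *\<^sub>R \<phi>uu q + (2 * b * c) *\<^sub>R \<phi>uv q + c\<^sup>2 *\<^sub>R \<phi>vv q) (at 0)"
      by (rule C2_param_line[OF C2 q, of b c]) (rule that)
    have "\<sigma> * (\<phi> (q + r *\<^sub>R (b,c)) $ 4 - v (hcosh a (\<phi> (q + r *\<^sub>R (b,c))))) 
        \<le> \<sigma> * (\<phi> (q + 0 *\<^sub>R (b,c)) $ 4 - v (hcosh a (\<phi> (q + 0 *\<^sub>R (b,c)))))" if "\<bar>r\<bar> < e" for r 
      using max[OF e(2)[OF that]] by simp
    from curve_height_max[OF e(1,3,4) v this \<sigma>] show ?thesis by (simp add: w_def)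
  qed
  show "\<phi>u q $ 4 = v1 w * x'" "\<phi>v q $ 4 = v1 w * y'"
    using *[of 1 0] *[of 0 1] by (simp_all add: x'_def y'_def)
  show "\<sigma> * (b\<^sup>2 * (\<phi>uu q $ 4 - v2 w * x'\<^sup>2 - v1 w * hcosh a (\<phi>uu q))
      + 2 * b * c * (\<phi>uv q $ 4 - v2 w * x' * y' - v1 w * hcosh a (\<phi>uv q))
      + c\<^sup>2 * (\<phi>vv q $ 4 - v2 w * y'\<^sup>2 - v1 w * hcosh a (\<phi>vv q))) \<le> 0"
  proof -
    have "b\<^sup>2 * (\<phi>uu q $ 4 - v2 w * x'\<^sup>2 - v1 w * hcosh a (\<phi>uu q))
      + 2 * b * c * (\<phi>uv q $ 4 - v2 w * x' * y' - v1 w * hcosh a (\<phi>uv q))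
      + c\<^sup>2 * (\<phi>vv q $ 4 - v2 w * y'\<^sup>2 - v1 w * hcosh a (\<phi>vv q)) = 
      (b\<^sup>2 *\<^sub>R \<phi>uu q + (2 * b * c) *\<^sub>R \<phi>uv q + c\<^sup>2 *\<^sub>R \<phi>vv q) $ 4
      - v2 w * (hcosh a (b *\<^sub>R \<phi>u q + c *\<^sub>R \<phi>v q))\<^sup>2
      - v1 w * hcosh a (b\<^sup>2 *\<^sub>R \<phi>uu q + (2 * b * c) *\<^sub>R \<phi>uv q + c\<^sup>2 *\<^sub>R \<phi>vv q)"
      by (simp add: x'_def y'_def power2_eq_square algebra_simps)
    then show ?thesis using *[of b c] by (simp only:)
  qed
qed

section \<open>Comparison with radial graphs\<close>

text \<open>The expression is the determinant times the trace of D with respect to the metric. The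
  direction (-F, E) is orthogonal to the first coordinate vector, and E times the expression is D on
  that direction plus (E G - F^2) times D on (1, 0).\<close>

lemma trace_nonpos:
  fixes E F G :: real
  assumes "0 \<le> E" and gram: "0 < E * G - F\<^sup>2"
    and D: "\<And>b c. b\<^sup>2 * DXX + 2 * b * c * DXY + c\<^sup>2 * DYY \<le> 0"
  shows "E * DYY - 2 * F * DXY + G * DXX \<le> 0"
proof -
  have "E \<noteq> 0" using gram by auto
  then have E: "E > 0" using assms(1) by simp
  have "E * (E * DYY - 2 * F * DXY + G * DXX) =
      ((- F)\<^sup>2 * DXX + 2 * (- F) * E * DXY + E\<^sup>2 * DYY) + (E * G - F\<^sup>2) * DXX"
    by (simp add: algebra_simps power2_eq_square)
  moreover have "DXX \<le> 0" using D[of 1 0] by simp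
  then have "(E * G - F\<^sup>2) * DXX \<le> 0" using gram by (simp add: mult_le_0_iff)
  ultimately have "E * (E * DYY - 2 * F * DXY + G * DXX) \<le> 0" using D[of "-F" E] by linarith
  then show ?thesis using E by (simp add: mult_le_0_iff)
qed

text \<open>Twice the mean curvature of a radial graph with slope p and second derivative p',
  measured against the normal of height component 1. The graph is a soliton exactly when the value
  is 2.\<close>

definition radial_mean_curv :: "real \<Rightarrow> real \<Rightarrow> real \<Rightarrow> real" where
  "radial_mean_curv p p' w = (p' - p^3 * w) * (w\<^sup>2 - 1) / (1 + p\<^sup>2 * (w\<^sup>2 - 1)) + 2 * p * w"

text \<open>At a critical point of z - v(w) the unit normal of M is a nonzero multiple d of
  \<open>graph_normal\<close>. The mean curvature and the height component both scale with d, so d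
  cancels, whichever way M is oriented.\<close>

lemma translator_chart_identity:
  fixes a :: "real^4" and p v2 :: real
  assumes a: "vaxis a" and tr: "translator M \<eta>"
    and C2: "C2_param U \<phi> \<phi>u \<phi>v \<phi>uu \<phi>uv \<phi>vv" and im: "immersion U \<phi> \<phi>u \<phi>v" and M: "\<phi> ` U \<subseteq> M"
    and q: "q \<in> U" and slope: "\<phi>u q $ 4 = p * hcosh a (\<phi>u q)" "\<phi>v q $ 4 = p * hcosh a (\<phi>v q)"
    and D: "DXX = \<phi>uu q $ 4 - v2 * (hcosh a (\<phi>u q))\<^sup>2 - p * hcosh a (\<phi>uu q)"
      "DXY = \<phi>uv q $ 4 - v2 * hcosh a (\<phi>u q) * hcosh a (\<phi>v q) - p * hcosh a (\<phi>uv q)"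
      "DYY = \<phi>vv q $ 4 - v2 * (hcosh a (\<phi>v q))\<^sup>2 - p * hcosh a (\<phi>vv q)"
  shows "(mink (\<phi>u q) (\<phi>u q) * DYY - 2 * mink (\<phi>u q) (\<phi>v q) * DXY + mink (\<phi>v q) (\<phi>v q) * DXX) 
      / (mink (\<phi>u q) (\<phi>u q) * mink (\<phi>v q) (\<phi>v q) - (mink (\<phi>u q) (\<phi>v q))\<^sup>2)
    + radial_mean_curv p v2 (hcosh a (\<phi> q)) = 2"
proof -
  have imH: "\<phi> ` U \<subseteq> HxR" and gram: "mink (\<phi>u q) (\<phi>u q) * mink (\<phi>v q) (\<phi>v q) - (mink (\<phi>u q) (\<phi>v q))\<^sup>2 > 0"
    using im q by (auto simp: immersion_def)
  have x: "\<phi> q \<in> HxR" using imH q by blast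
  note tan = chart_tangency[OF C2 imH q]
  define n where "n = graph_normal a p (\<phi> q)"
  note mc = mean_curv_graph_normal[OF a x gram tan(1,2) slope tan(3-5) D, folded n_def]
  note nf = graph_normal_facts[OF a x, of p, folded n_def]
  have nn: "mink n n > 0" using nf(3,4) by simp
  have un: "unit_normal M \<eta>" using tr by (simp add: translator_def)
  have \<eta>: "mink (\<eta> (\<phi> q)) (\<eta> (\<phi> q)) = 1" "mink (\<eta> (\<phi> q)) (hpart (\<phi> q)) = 0"
    using un M q unfolding unit_normal_def by blast+
  have \<eta>': "mink (\<eta> (\<phi> q)) (\<phi>u q) = 0" "mink (\<eta> (\<phi> q)) (\<phi>v q) = 0"
    using un C2 im M q unfolding unit_normal_def by blast+
  obtain d where d: "\<eta> (\<phi> q) = d *\<^sub>R n"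
    by (rule normal_unique[OF x tan(1,2) nf(1) mc(2,3) nn gram \<eta>(2) \<eta>'])
  have "d \<noteq> 0" using \<eta>(1) d by auto
  have "mean_curv (\<phi>u q) (\<phi>v q) (\<phi>uu q) (\<phi>uv q) (\<phi>vv q) (\<eta> (\<phi> q)) = mink (\<eta> (\<phi> q)) ez"
    using tr C2 im M q unfolding translator_def by blast
  then have "mean_curv (\<phi>u q) (\<phi>v q) (\<phi>uu q) (\<phi>uv q) (\<phi>vv q) n = 1"
    using \<open>d \<noteq> 0\<close> nf(2) unfolding d mean_curv_scaleR by simp
  then show ?thesis using mc(1) by (simp add: radial_mean_curv_def)
qed

text \<open>The second derivatives of z - v(w) are semidefinite at the touching point, so their
  trace has the sign opposite to \<sigma>; in the chart identity \<open>radial_mean_curv\<close>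
  must compensate for it to reach 2.\<close>

lemma translator_touching_radial_graph:
  fixes v v1 v2 :: "real \<Rightarrow> real"
  assumes a: "vaxis a" and tr: "translator M \<eta>" and x0: "x0 \<in> M" "interior_chart M x0"
    and v: "\<And>w. (v has_real_derivative v1 w) (at w)" "\<And>w. (v1 has_real_derivative v2 w) (at w)"
    and max: "\<And>x. x \<in> M \<Longrightarrow> \<sigma> * (x $ 4 - v (hcosh a x)) \<le> \<sigma> * (x0 $ 4 - v (hcosh a x0))"
    and \<sigma>: "\<sigma> \<noteq> 0"
  defines "w \<equiv> hcosh a x0"
  shows "\<sigma> * (radial_mean_curv (v1 w) (v2 w) w - 2) \<ge> 0"
proof -
  obtain U V \<phi> \<phi>u \<phi>v \<phi>uu \<phi>uv \<phi>vv \<psi> where C2: "C2_param U \<phi> \<phi>u \<phi>v \<phi>uu \<phi>uv \<phi>vv"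
    and im: "immersion U \<phi> \<phi>u \<phi>v" and V: "open V" "x0 \<in> V" and hom: "homeomorphism U (M \<inter> V) \<phi> \<psi>"
    using x0(2) unfolding interior_chart_def by blast
  define q where "q = \<psi> x0"
  have q: "q \<in> U" "\<phi> q = x0" using hom V(2) x0(1) by (auto simp: q_def homeomorphism_def)
  have UM: "\<phi> ` U \<subseteq> M" using hom by (auto simp: homeomorphism_def)
  have imH: "\<phi> ` U \<subseteq> HxR" and gram: "mink (\<phi>u q) (\<phi>u q) * mink (\<phi>v q) (\<phi>v q) - (mink (\<phi>u q) (\<phi>v q))\<^sup>2 > 0"
    using im q by (auto simp: immersion_def)
  have x: "\<phi> q \<in> HxR" using imH q by blast
  have max': "\<sigma> * (\<phi> r $ 4 - v (hcosh a (\<phi> r))) \<le> \<sigma> * (\<phi> q $ 4 - v (hcosh a (\<phi> q)))" if "r \<in> U" for r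
    using max[of "\<phi> r"] UM that q(2) by auto
  note chm = chart_height_max[OF C2 q(1) v max' \<sigma>, unfolded q(2), folded w_def]
  define DXX where "DXX = \<phi>uu q $ 4 - v2 w * (hcosh a (\<phi>u q))\<^sup>2 - v1 w * hcosh a (\<phi>uu q)"
  define DXY where "DXY = \<phi>uv q $ 4 - v2 w * hcosh a (\<phi>u q) * hcosh a (\<phi>v q) - v1 w * hcosh a (\<phi>uv q)"
  define DYY where "DYY = \<phi>vv q $ 4 - v2 w * (hcosh a (\<phi>v q))\<^sup>2 - v1 w * hcosh a (\<phi>vv q)"
  define E F G where "E = mink (\<phi>u q) (\<phi>u q)" and "F = mink (\<phi>u q) (\<phi>v q)" and "G = mink (\<phi>v q) (\<phi>v q)"
  have id: "(E * DYY - 2 * F * DXY + G * DXX) / (E * G - F\<^sup>2) + radial_mean_curv (v1 w) (v2 w) w = 2"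
    using translator_chart_identity[OF a tr C2 im UM q(1) chm(1,2) DXX_def DXY_def DYY_def]
    by (simp add: E_def F_def G_def q(2) w_def)
  have "E \<ge> 0" 
    using tangent_hpart_nonneg[OF x chart_tangency(1)[OF C2 imH q(1)]] 
    unfolding E_def by (subst mink_split) simp
  moreover have "b\<^sup>2 * (\<sigma> * DXX) + 2 * b * c * (\<sigma> * DXY) + c\<^sup>2 * (\<sigma> * DYY) \<le> 0" for b c
    using chm(3)[of b c, folded DXX_def DXY_def DYY_def] by (simp add: algebra_simps)
  ultimately have "E * (\<sigma> * DYY) - 2 * F * (\<sigma> * DXY) + G * (\<sigma> * DXX) \<le> 0"
    using gram by (intro trace_nonpos) (simp_all add: E_def F_def G_def)
  then have "\<sigma> * (E * DYY - 2 * F * DXY + G * DXX) \<le> 0" by (simp add: algebra_simps)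
  then have "\<sigma> * (E * DYY - 2 * F * DXY + G * DXX) / (E * G - F\<^sup>2) \<le> 0"
    using gram unfolding E_def F_def G_def by (simp add: divide_le_0_iff)
  then have "\<sigma> * ((E * DYY - 2 * F * DXY + G * DXX) / (E * G - F\<^sup>2)) \<le> 0" by simp
  moreover have "radial_mean_curv (v1 w) (v2 w) w - 2 = - ((E * DYY - 2 * F * DXY + G * DXX) / (E * G - F\<^sup>2))"
    using id by linarith
  ultimately show ?thesis by simp
qed

text \<open>Here u = f w is the height of the bowl over points at distance arcosh w from the axis.
The slope g extends past w = 1 by a constant, so that f is of class C2 on the whole line.\<close>

locale bowl_profile =
  fixes f g g' :: "real \<Rightarrow> real"
  assumes f: "\<And>w. (f has_real_derivative g w) (at w)"
    and g: "\<And>w. (g has_real_derivative g' w) (at w)"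
    and cont_g': "continuous_on UNIV g'"
    and g_nonneg: "\<And>w. w \<ge> 1 \<Longrightarrow> 0 \<le> g w"
    and g_le: "\<And>w. w \<ge> 1 \<Longrightarrow> g w * w \<le> 2"
    and ode: "\<And>w. w \<ge> 1 \<Longrightarrow> 
      (w\<^sup>2 - 1) * g' w = (2 - g w * w) * (1 + (g w)\<^sup>2 * (w\<^sup>2 - 1)) - g w * w"
begin

text \<open>Clearing the denominator leaves a cubic polynomial in \<epsilon>; the profile equation
  removes its constant term, so a factor \<epsilon> comes out.\<close>

lemma radial_mean_curv_perturbed:
  assumes w: "w \<ge> 1"
  shows "(1 + (g w - \<epsilon>)\<^sup>2 * (w\<^sup>2 - 1)) * (radial_mean_curv (g w - \<epsilon>) (g' w) w - 2) =
    - \<epsilon> * (2 * w + 3 * w * (g w)\<^sup>2 * (w\<^sup>2 - 1) - 4 * g w * (w\<^sup>2 - 1)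
      + \<epsilon> * (w\<^sup>2 - 1) * (2 - 3 * (g w * w)) + w * \<epsilon>\<^sup>2 * (w\<^sup>2 - 1))"
proof -
  define r where "r = w\<^sup>2 - 1"
  define p where "p = g w - \<epsilon>"
  have "0 \<le> r" using w by (simp add: r_def)
  then have "0 \<le> p\<^sup>2 * r" by simp
  then have W: "1 + p\<^sup>2 * r \<noteq> 0" by linarith
  have "(1 + p\<^sup>2 * r) * (radial_mean_curv p (g' w) w - 2) = 
      (g' w - p^3 * w) * r + (1 + p\<^sup>2 * r) * (2 * p * w - 2)"
    using W unfolding radial_mean_curv_def r_def[symmetric] by (simp add: distrib_left right_diff_distrib)
  also have "\<dots> = r * g' w + p * w - (2 - p * w) * (1 + p\<^sup>2 * r)"
    by (simp add: algebra_simps power2_eq_square power3_eq_cube)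
  also have "r * g' w = (2 - g w * w) * (1 + (g w)\<^sup>2 * r) - g w * w"
    unfolding r_def by (rule ode[OF w])
  finally show ?thesis
    unfolding r_def[symmetric] p_def by (simp add: algebra_simps power2_eq_square)
qed

lemma radial_mean_curv_bowl:
  assumes w: "w \<ge> 1"
  shows "radial_mean_curv (g w) (g' w) w = 2"
proof -
  have "0 \<le> (g w)\<^sup>2 * (w\<^sup>2 - 1)" using w by simp
  then have "1 + (g w)\<^sup>2 * (w\<^sup>2 - 1) \<noteq> 0" by linarith
  then show ?thesis using radial_mean_curv_perturbed[OF w, of 0] by simp
qed

text \<open>The leading coefficient Q is at least 2/3. As g w * w lies between 0 and 2, the next
  term is at most 4 |\<epsilon>| (w^2 - 1) in absolute value; the constant 9 brings this down to 4/9
  < 2/3. The last term is nonnegative.\<close>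

lemma radial_mean_curv_barrier:
  assumes w: "w \<ge> 1" and \<epsilon>: "\<epsilon> \<noteq> 0" "9 * \<bar>\<epsilon>\<bar> * (w\<^sup>2 - 1) \<le> 1"
  shows "\<epsilon> * (radial_mean_curv (g w - \<epsilon>) (g' w) w - 2) < 0"
proof -
  define r where "r = w\<^sup>2 - 1"
  have r: "0 \<le> r" using w by (simp add: r_def)
  define Q where "Q = 2 * w + 3 * w * (g w)\<^sup>2 * r - 4 * g w * r"
  define S where "S = Q + \<epsilon> * r * (2 - 3 * (g w * w)) + w * \<epsilon>\<^sup>2 * r"
  have "3 * w * Q = r * (3 * (g w * w) - 2)\<^sup>2 - 4 * r + 6 * w\<^sup>2"
    \<comment> \<open>completing the square in g w\<close>
    by (simp add: Q_def algebra_simps power2_eq_square)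
  moreover have "0 \<le> r * (3 * (g w * w) - 2)\<^sup>2" using r by simp
  moreover have "4 * r = 4 * w\<^sup>2 - 4" by (simp add: r_def)
  ultimately have "2 * w\<^sup>2 \<le> 3 * w * Q" by linarith
  then have "w * (2 * w) \<le> w * (3 * Q)" by (simp add: power2_eq_square mult_ac)
  then have "2 * w \<le> 3 * Q" using w by simp
  then have 1: "2 / 3 \<le> Q" using w by linarith
  have "0 \<le> g w * w" "g w * w \<le> 2" using g_nonneg[OF w] g_le[OF w] w by auto
  then have "\<bar>2 - 3 * (g w * w)\<bar> \<le> 4" by (intro abs_leI) linarith+
  then have "\<bar>\<epsilon> * r\<bar> * \<bar>2 - 3 * (g w * w)\<bar> \<le> (1/9) * 4"
    using \<epsilon>(2) r by (intro mult_mono) (auto simp: abs_mult r_def)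
  then have 2: "\<bar>\<epsilon> * r * (2 - 3 * (g w * w))\<bar> \<le> 4/9" by (simp add: abs_mult)
  have 3: "0 \<le> w * \<epsilon>\<^sup>2 * r" using r w by simp
  have S: "S > 0" unfolding S_def using 1 2 3 by linarith
  have "0 \<le> (g w - \<epsilon>)\<^sup>2 * r" using r by simp
  then have W: "0 < 1 + (g w - \<epsilon>)\<^sup>2 * r" by linarith
  have "(1 + (g w - \<epsilon>)\<^sup>2 * r) * (\<epsilon> * (radial_mean_curv (g w - \<epsilon>) (g' w) w - 2)) = 
      \<epsilon> * ((1 + (g w - \<epsilon>)\<^sup>2 * r) * (radial_mean_curv (g w - \<epsilon>) (g' w) w - 2))" by simp
  also have "\<dots> = - (\<epsilon>\<^sup>2 * S)"
    unfolding r_def radial_mean_curv_perturbed[OF w] S_def Q_def by (simp add: power2_eq_square)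
  also have "\<dots> < 0" using S \<epsilon>(1) by simp
  finally show ?thesis using W by (simp add: mult_less_0_iff)
qed

lemma translator_on_bowl:
  assumes a: "vaxis a" and M: "compact M" "M \<subseteq> HxR" and tr: "translator M \<eta>"
    and bd: "\<And>x. x \<in> mbdry M \<Longrightarrow> hcosh a x = w0 \<and> x $ 4 = t0" and x: "x \<in> M"
  shows "x $ 4 - f (hcosh a x) = t0 - f w0"
proof -
  have conth: "continuous_on S (hcosh a)" for S
    using bounded_linear_hcosh by (rule linear_continuous_on)
  have "compact ((\<lambda>x. (hcosh a x)\<^sup>2 - 1) ` M)"
    using M(1) by (intro compact_continuous_image continuous_intros conth)
  from compact_imp_bounded[OF this] obtain K where K: "\<And>x. x \<in> M \<Longrightarrow> \<bar>(hcosh a x)\<^sup>2 - 1\<bar> \<le> K"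
    by (auto simp: bounded_iff)
  have K0: "0 \<le> K" using K[OF x] by linarith
  \<comment> \<open>Makes the hypothesis of the barrier estimate hold at every point of M; K + 1
    keeps the denominator positive even if M lies on the axis.\<close>
  define e where "e = 1 / (9 * (K + 1))"
  have e: "e > 0" using K0 by (simp add: e_def)
  define A where "A = (x $ 4 - f (hcosh a x)) - (t0 - f w0)"
  define B where "B = w0 - hcosh a x"
  \<comment> \<open>Taking \<sigma> = \<epsilon> treats both signs at once: z - v(w) is maximised
    for positive and minimised for negative \<epsilon>. An interior extremum is excluded because
    touching gives a nonnegative and the barrier a negative value of the same product.\<close>
  have main: "\<epsilon> * A \<le> \<epsilon> * (\<epsilon> * B)" if \<epsilon>: "\<epsilon> \<noteq> 0" "\<bar>\<epsilon>\<bar> \<le> e" for \<epsilon>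
  proof -
    define v where "v w = f w - \<epsilon> * w" for w
    have v: "(v has_real_derivative g w - \<epsilon>) (at w)" "((\<lambda>w. g w - \<epsilon>) has_real_derivative g' w) (at w)" for w
      unfolding v_def by (auto intro!: derivative_eq_intros f g)
    have contv: "continuous_on S v" for S
      using v(1) by (intro continuous_at_imp_continuous_on ballI DERIV_isCont)
    have "continuous_on M (\<lambda>x. \<epsilon> * (x $ 4 - v (hcosh a x)))"
      by (intro continuous_intros continuous_on_compose2[OF contv conth]) auto
    from continuous_attains_sup[OF M(1) _ this] x
    obtain x0 where x0: "x0 \<in> M"
      "\<And>y. y \<in> M \<Longrightarrow> \<epsilon> * (y $ 4 - v (hcosh a y)) \<le> \<epsilon> * (x0 $ 4 - v (hcosh a x0))"
      by auto
    have "x0 \<in> mbdry M"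
    proof (rule ccontr)
      assume "x0 \<notin> mbdry M"
      then have ic: "interior_chart M x0" using x0(1) by (simp add: mbdry_def)
      have w1: "1 \<le> hcosh a x0" using hcosh_ge_1[OF a] M(2) x0(1) by blast
      have "9 * \<bar>\<epsilon>\<bar> * ((hcosh a x0)\<^sup>2 - 1) \<le> 9 * e * (K + 1)"
        using \<epsilon>(2) K[OF x0(1)] K0 e w1 by (intro mult_mono) auto
      also have "\<dots> = 1" using K0 by (simp add: e_def)
      finally show False
        using translator_touching_radial_graph[OF a tr x0(1) ic v x0(2) \<epsilon>(1)]
          radial_mean_curv_barrier[OF w1 \<epsilon>(1)] by simp
    qed
    from bd[OF this] x0(2)[OF x]
    have "\<epsilon> * (x $ 4 - v (hcosh a x)) \<le> \<epsilon> * (t0 - v w0)" by simp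
    then show ?thesis by (simp add: A_def B_def v_def algebra_simps)
  qed
  have "A \<le> 0"
  proof (rule ccontr)
    assume "\<not> A \<le> 0"
    \<comment> \<open>Chosen so that \<epsilon> B is at most A / 2, against A \<le> \<epsilon>
      B.\<close>
    define \<epsilon> where "\<epsilon> = min e (A / (2 * (\<bar>B\<bar> + 1)))"
    have \<epsilon>: "0 < \<epsilon>" "\<epsilon> \<le> e" using e \<open>\<not> A \<le> 0\<close> by (auto simp: \<epsilon>_def)
    have "A \<le> \<epsilon> * B" using main[of \<epsilon>] \<epsilon> by simp
    also have "\<dots> \<le> \<epsilon> * (\<bar>B\<bar> + 1)" using \<epsilon> by (intro mult_left_mono) auto
    also have "\<dots> \<le> A / (2 * (\<bar>B\<bar> + 1)) * (\<bar>B\<bar> + 1)" by (intro mult_right_mono) (auto simp: \<epsilon>_def)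
    also have "\<dots> = A / 2" by (simp add: field_simps)
    finally show False using \<open>\<not> A \<le> 0\<close> by simp
  qed
  moreover have "0 \<le> A"
  proof (rule ccontr)
    assume "\<not> 0 \<le> A"
    define \<epsilon> where "\<epsilon> = min e (- A / (2 * (\<bar>B\<bar> + 1)))"
    have \<epsilon>: "0 < \<epsilon>" "\<epsilon> \<le> e" using e \<open>\<not> 0 \<le> A\<close> by (auto simp: \<epsilon>_def divide_neg_pos)
    have "\<epsilon> * (- A) \<le> \<epsilon> * (\<epsilon> * B)" using main[of "- \<epsilon>"] \<epsilon> by simp
    then have "- A \<le> \<epsilon> * B" using \<epsilon>(1) by (simp only: mult_le_cancel_left_pos)
    also have "\<dots> \<le> \<epsilon> * (\<bar>B\<bar> + 1)" using \<epsilon> by (intro mult_left_mono) auto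
    also have "\<dots> \<le> - A / (2 * (\<bar>B\<bar> + 1)) * (\<bar>B\<bar> + 1)" by (intro mult_right_mono) (auto simp: \<epsilon>_def)
    also have "\<dots> = - A / 2" by (simp add: field_simps)
    finally show False using \<open>\<not> 0 \<le> A\<close> by simp
  qed
  ultimately show ?thesis by (simp add: A_def)
qed

end

section \<open>The bowl soliton\<close>

definition pt :: "real \<Rightarrow> real \<Rightarrow> real \<Rightarrow> real \<Rightarrow> real^4" where
  "pt x y z u = x *\<^sub>R axis 1 1 + y *\<^sub>R axis 2 1 + z *\<^sub>R axis 3 1 + u *\<^sub>R axis 4 1"

lemma pt_nth [simp]: "pt x y z u $ 1 = x" "pt x y z u $ 2 = y" "pt x y z u $ 3 = z" "pt x y z u $ 4 = u"
  by (simp_all add: pt_def axis_def)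

lemma pt_has_vector_derivative:
  assumes "(x has_real_derivative x') (at s)" "(y has_real_derivative y') (at s)"
    "(z has_real_derivative z') (at s)" "(u has_real_derivative u') (at s)"
  shows "((\<lambda>s. pt (x s) (y s) (z s) (u s)) has_vector_derivative pt x' y' z' u') (at s)"
  unfolding pt_def using assms
  by (intro has_vector_derivative_add)
    (auto intro: bounded_linear.has_vector_derivative[OF bounded_linear_scaleR_left]
      simp: has_real_derivative_iff_has_vector_derivative)

lemma continuous_on_pt [continuous_intros]:
  assumes "continuous_on S x" "continuous_on S y" "continuous_on S z" "continuous_on S u"
  shows "continuous_on S (\<lambda>s. pt (x s) (y s) (z s) (u s))"
  unfolding pt_def using assms by (intro continuous_intros)

context bowl_profile
begin

lemma continuous_on_fg: "continuous_on S f" "continuous_on S g" "continuous_on S g'"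
proof -
  show "continuous_on S f" using f by (intro continuous_at_imp_continuous_on ballI DERIV_isCont)
  show "continuous_on S g" using g by (intro continuous_at_imp_continuous_on ballI DERIV_isCont)
  show "continuous_on S g'" using cont_g' continuous_on_subset by blast
qed

definition bowl_graph :: "real^4 \<Rightarrow> (real^4) set" where
  "bowl_graph a = {x\<in>HxR. x $ 4 = f (hcosh a x)}"

lemma bowl_graph_eq_vgraph: "vaxis a \<Longrightarrow> bowl_graph a = vgraph (\<lambda>h. f (hcosh a h))"
  by (simp add: bowl_graph_def vgraph_def hcosh_hpart)

text \<open>The first two coordinates form a global chart of the hyperbolic plane, with third
  coordinate r; h is w in this chart, and hs, ht are its partial derivatives.\<close>

lemma emb_surface_bowl_graph:
  assumes a: "vaxis a"
  shows "emb_surface (bowl_graph a)"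
proof -
  define r where "r q = sqrt (1 + (fst q)\<^sup>2 + (snd q)\<^sup>2)" for q :: "real \<times> real"
  define h where "h q = a$3 * r q - a$1 * fst q - a$2 * snd q" for q
  define hs where "hs q = a$3 * (fst q / r q) - a$1" for q
  define ht where "ht q = a$3 * (snd q / r q) - a$2" for q
  define \<phi> where "\<phi> q = pt (fst q) (snd q) (r q) (f (h q))" for q
  define \<phi>u where "\<phi>u q = pt 1 0 (fst q / r q) (g (h q) * hs q)" for q
  define \<phi>v where "\<phi>v q = pt 0 1 (snd q / r q) (g (h q) * ht q)" for q
  define \<phi>uu where "\<phi>uu q = pt 0 0 ((1 + (snd q)\<^sup>2) / r q ^ 3)
    (g' (h q) * hs q * hs q + a$3 * ((1 + (snd q)\<^sup>2) / r q ^ 3) * g (h q))" for q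
  define \<phi>uv where "\<phi>uv q = pt 0 0 (- (fst q * snd q) / r q ^ 3)
    (g' (h q) * hs q * ht q + a$3 * (- (fst q * snd q) / r q ^ 3) * g (h q))" for q
  define \<phi>vv where "\<phi>vv q = pt 0 0 ((1 + (fst q)\<^sup>2) / r q ^ 3)
    (g' (h q) * ht q * ht q + a$3 * ((1 + (fst q)\<^sup>2) / r q ^ 3) * g (h q))" for q
  define \<psi> where "\<psi> x = (x$1, x$2)" for x :: "real^4"
  have rarg: "0 < 1 + (fst q)\<^sup>2 + (snd q)\<^sup>2" for q :: "real \<times> real"
    using zero_le_power2[of "fst q"] zero_le_power2[of "snd q"] by linarith
  have r: "r q > 0" and r2: "(r q)\<^sup>2 = 1 + (fst q)\<^sup>2 + (snd q)\<^sup>2" for q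
    using rarg[of q] by (simp_all add: r_def)
  have rs: "((\<lambda>s. r (s,t)) has_real_derivative s / r (s,t)) (at s)" 
    and rt: "((\<lambda>t. r (s,t)) has_real_derivative t / r (s,t)) (at t)" for s t
  proof -
    have p: "0 < 1 + s\<^sup>2 + t\<^sup>2" using rarg[of "(s,t)"] by simp
    have D: "((\<lambda>s. 1 + s\<^sup>2 + t\<^sup>2) has_real_derivative 2 * s) (at s)"
      "((\<lambda>t. 1 + s\<^sup>2 + t\<^sup>2) has_real_derivative 2 * t) (at t)"
      by (auto intro!: derivative_eq_intros)
    show "((\<lambda>s. r (s,t)) has_real_derivative s / r (s,t)) (at s)" 
      "((\<lambda>t. r (s,t)) has_real_derivative t / r (s,t)) (at t)"
      using DERIV_chain2[OF DERIV_real_sqrt[OF p] D(1)] DERIV_chain2[OF DERIV_real_sqrt[OF p] D(2)]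
      by (simp_all add: r_def inverse_eq_divide)
  qed
  have rss: "((\<lambda>s. s / r (s,t)) has_real_derivative (1 + t\<^sup>2) / r (s,t) ^ 3) (at s)" for s t
  proof -
    have "((\<lambda>s. s / r (s,t)) has_real_derivative (1 * r (s,t) - s * (s / r (s,t))) / (r (s,t) * r (s,t))) (at s)"
      using r[of "(s,t)"] by (intro DERIV_divide DERIV_ident rs) auto
    moreover have "1 * r (s,t) - s * (s / r (s,t)) = ((r (s,t))\<^sup>2 - s\<^sup>2) / r (s,t)"
      using r[of "(s,t)"] by (simp add: diff_divide_distrib power2_eq_square)
    ultimately show ?thesis by (simp add: r2 power3_eq_cube mult.assoc)
  qed
  have rtt: "((\<lambda>t. t / r (s,t)) has_real_derivative (1 + s\<^sup>2) / r (s,t) ^ 3) (at t)" for s t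
  proof -
    have "((\<lambda>t. t / r (s,t)) has_real_derivative (1 * r (s,t) - t * (t / r (s,t))) / (r (s,t) * r (s,t))) (at t)"
      using r[of "(s,t)"] by (intro DERIV_divide DERIV_ident rt) auto
    moreover have "1 * r (s,t) - t * (t / r (s,t)) = ((r (s,t))\<^sup>2 - t\<^sup>2) / r (s,t)"
      using r[of "(s,t)"] by (simp add: diff_divide_distrib power2_eq_square)
    ultimately show ?thesis by (simp add: r2 power3_eq_cube mult.assoc)
  qed
  have rst: "((\<lambda>t. s / r (s,t)) has_real_derivative - (s * t) / r (s,t) ^ 3) (at t)"
    and rts: "((\<lambda>s. t / r (s,t)) has_real_derivative - (s * t) / r (s,t) ^ 3) (at s)" for s t
  proof -
    have "((\<lambda>t. s / r (s,t)) has_real_derivative (0 * r (s,t) - s * (t / r (s,t))) / (r (s,t) * r (s,t))) (at t)"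
      using r[of "(s,t)"] by (intro DERIV_divide DERIV_const rt) auto
    then show "((\<lambda>t. s / r (s,t)) has_real_derivative - (s * t) / r (s,t) ^ 3) (at t)"
      by (simp add: power3_eq_cube mult.assoc)
    have "((\<lambda>s. t / r (s,t)) has_real_derivative (0 * r (s,t) - t * (s / r (s,t))) / (r (s,t) * r (s,t))) (at s)"
      using r[of "(s,t)"] by (intro DERIV_divide DERIV_const rs) auto
    then show "((\<lambda>s. t / r (s,t)) has_real_derivative - (s * t) / r (s,t) ^ 3) (at s)"
      by (simp add: power3_eq_cube mult_ac)
  qed
  have hs: "((\<lambda>s. h (s,t)) has_real_derivative hs (s,t)) (at s)" 
    and ht: "((\<lambda>t. h (s,t)) has_real_derivative ht (s,t)) (at t)" for s t
    by (auto simp: h_def hs_def ht_def intro!: derivative_eq_intros rs rt)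
  have hss: "((\<lambda>s. hs (s,t)) has_real_derivative a$3 * ((1 + t\<^sup>2) / r (s,t) ^ 3)) (at s)"
    and hst: "((\<lambda>t. hs (s,t)) has_real_derivative a$3 * (- (s * t) / r (s,t) ^ 3)) (at t)"
    and hts: "((\<lambda>s. ht (s,t)) has_real_derivative a$3 * (- (s * t) / r (s,t) ^ 3)) (at s)"
    and htt: "((\<lambda>t. ht (s,t)) has_real_derivative a$3 * ((1 + s\<^sup>2) / r (s,t) ^ 3)) (at t)" for s t
  proof -
    show "((\<lambda>s. hs (s,t)) has_real_derivative a$3 * ((1 + t\<^sup>2) / r (s,t) ^ 3)) (at s)"
      using DERIV_diff[OF DERIV_cmult[OF rss] DERIV_const] by (simp add: hs_def)
    show "((\<lambda>t. hs (s,t)) has_real_derivative a$3 * (- (s * t) / r (s,t) ^ 3)) (at t)"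
      using DERIV_diff[OF DERIV_cmult[OF rst] DERIV_const] by (simp add: hs_def)
    show "((\<lambda>s. ht (s,t)) has_real_derivative a$3 * (- (s * t) / r (s,t) ^ 3)) (at s)"
      using DERIV_diff[OF DERIV_cmult[OF rts] DERIV_const] by (simp add: ht_def)
    show "((\<lambda>t. ht (s,t)) has_real_derivative a$3 * ((1 + s\<^sup>2) / r (s,t) ^ 3)) (at t)"
      using DERIV_diff[OF DERIV_cmult[OF rtt] DERIV_const] by (simp add: ht_def)
  qed
  have contr: "continuous_on UNIV r" unfolding r_def by (intro continuous_intros)
  have conth: "continuous_on UNIV h" unfolding h_def by (intro continuous_intros contr)
  have rn0: "\<forall>q\<in>UNIV. r q \<noteq> 0" "\<forall>q\<in>UNIV. r q ^ 3 \<noteq> 0" using r by (auto simp: less_le)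
  have conths: "continuous_on UNIV hs" "continuous_on UNIV ht"
    unfolding hs_def ht_def using rn0 by (intro continuous_intros contr; simp)+
  have contf: "continuous_on UNIV (\<lambda>q. f (h q))" "continuous_on UNIV (\<lambda>q. g (h q))" "continuous_on UNIV (\<lambda>q. g' (h q))"
    by (rule continuous_on_compose2[OF continuous_on_fg(1) conth subset_UNIV]
        continuous_on_compose2[OF continuous_on_fg(2) conth subset_UNIV]
        continuous_on_compose2[OF continuous_on_fg(3) conth subset_UNIV])+
  have "C2_param UNIV \<phi> \<phi>u \<phi>v \<phi>uu \<phi>uv \<phi>vv"
    unfolding C2_param_def
  proof (intro conjI ballI)
    show "continuous_on UNIV \<phi>u" "continuous_on UNIV \<phi>v" "continuous_on UNIV \<phi>uu"
      "continuous_on UNIV \<phi>uv" "continuous_on UNIV \<phi>vv"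
      unfolding \<phi>u_def \<phi>v_def \<phi>uu_def \<phi>uv_def \<phi>vv_def
      by (intro continuous_intros contr conths contf rn0)+
    fix q :: "real \<times> real"
    obtain s t where q: "q = (s,t)" by (cases q)
    show "case q of (s,t) \<Rightarrow>
        ((\<lambda>s'. \<phi> (s',t)) has_vector_derivative \<phi>u (s,t)) (at s) \<and>
        ((\<lambda>t'. \<phi> (s,t')) has_vector_derivative \<phi>v (s,t)) (at t) \<and>
        ((\<lambda>s'. \<phi>u (s',t)) has_vector_derivative \<phi>uu (s,t)) (at s) \<and>
        ((\<lambda>t'. \<phi>u (s,t')) has_vector_derivative \<phi>uv (s,t)) (at t) \<and>
        ((\<lambda>s'. \<phi>v (s',t)) has_vector_derivative \<phi>uv (s,t)) (at s) \<and>
        ((\<lambda>t'. \<phi>v (s,t')) has_vector_derivative \<phi>vv (s,t)) (at t)"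
      unfolding q prod.case
    proof (intro conjI)
      show "((\<lambda>s'. \<phi> (s',t)) has_vector_derivative \<phi>u (s,t)) (at s)"
        unfolding \<phi>_def \<phi>u_def fst_conv snd_conv
        by (intro pt_has_vector_derivative DERIV_ident DERIV_const rs DERIV_chain2[OF f hs])
      show "((\<lambda>t'. \<phi> (s,t')) has_vector_derivative \<phi>v (s,t)) (at t)"
        unfolding \<phi>_def \<phi>v_def fst_conv snd_conv
        by (intro pt_has_vector_derivative DERIV_ident DERIV_const rt DERIV_chain2[OF f ht])
      show "((\<lambda>s'. \<phi>u (s',t)) has_vector_derivative \<phi>uu (s,t)) (at s)"
        unfolding \<phi>u_def \<phi>uu_def fst_conv snd_conv
        by (intro pt_has_vector_derivative DERIV_const rss DERIV_mult DERIV_chain2[OF g hs] hss)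
      have comm: "g' (h (s,t)) * hs (s,t) * ht (s,t) = g' (h (s,t)) * ht (s,t) * hs (s,t)" by simp
      show "((\<lambda>t'. \<phi>u (s,t')) has_vector_derivative \<phi>uv (s,t)) (at t)"
        unfolding \<phi>u_def \<phi>uv_def fst_conv snd_conv
        unfolding comm
        by (intro pt_has_vector_derivative DERIV_const rst DERIV_mult DERIV_chain2[OF g ht] hst)
      show "((\<lambda>s'. \<phi>v (s',t)) has_vector_derivative \<phi>uv (s,t)) (at s)"
        unfolding \<phi>v_def \<phi>uv_def fst_conv snd_conv
        by (intro pt_has_vector_derivative DERIV_const rts DERIV_mult DERIV_chain2[OF g hs] hts)
      show "((\<lambda>t'. \<phi>v (s,t')) has_vector_derivative \<phi>vv (s,t)) (at t)"
        unfolding \<phi>v_def \<phi>vv_def fst_conv snd_conv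
        by (intro pt_has_vector_derivative DERIV_const rtt DERIV_mult DERIV_chain2[OF g ht] htt)
    qed
  qed simp
  moreover have \<phi>H: "\<phi> q \<in> HxR" for q using r[of q] r2[of q] by (simp add: \<phi>_def HxR_def)
  have "immersion UNIV \<phi> \<phi>u \<phi>v"
    unfolding immersion_def
  proof (intro conjI ballI)
    show "\<phi> ` UNIV \<subseteq> HxR" using \<phi>H by auto
    fix q :: "real \<times> real"
    define s t R x y where "s = fst q" and "t = snd q" and "R = r q" and "x = g (h q) * hs q" and "y = g (h q) * ht q"
    have R: "R > 0" "R\<^sup>2 = 1 + s\<^sup>2 + t\<^sup>2" using r r2 by (auto simp: R_def s_def t_def)
    have E: "mink (\<phi>u q) (\<phi>u q) = (1 + t\<^sup>2 + R\<^sup>2 * x\<^sup>2) / R\<^sup>2"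
      and F: "mink (\<phi>u q) (\<phi>v q) = (- (s * t) + R\<^sup>2 * (x * y)) / R\<^sup>2"
      and G: "mink (\<phi>v q) (\<phi>v q) = (1 + s\<^sup>2 + R\<^sup>2 * y\<^sup>2) / R\<^sup>2"
    proof -
      have "R\<^sup>2 / R\<^sup>2 - s\<^sup>2 / R\<^sup>2 = (1 + t\<^sup>2) / R\<^sup>2" "R\<^sup>2 / R\<^sup>2 - t\<^sup>2 / R\<^sup>2 = (1 + s\<^sup>2) / R\<^sup>2"
        unfolding diff_divide_distrib[symmetric] by (simp_all add: R(2))
      then have "1 - s\<^sup>2 / R\<^sup>2 = (1 + t\<^sup>2) / R\<^sup>2" "1 - t\<^sup>2 / R\<^sup>2 = (1 + s\<^sup>2) / R\<^sup>2"
        using R(1) by simp_all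
      then show "mink (\<phi>u q) (\<phi>u q) = (1 + t\<^sup>2 + R\<^sup>2 * x\<^sup>2) / R\<^sup>2"
        "mink (\<phi>u q) (\<phi>v q) = (- (s * t) + R\<^sup>2 * (x * y)) / R\<^sup>2"
        "mink (\<phi>v q) (\<phi>v q) = (1 + s\<^sup>2 + R\<^sup>2 * y\<^sup>2) / R\<^sup>2"
        using R(1) unfolding \<phi>u_def \<phi>v_def mink_def pt_nth 
          s_def[symmetric] t_def[symmetric] R_def[symmetric] x_def[symmetric] y_def[symmetric]
        by (simp_all add: add_divide_distrib diff_divide_distrib power2_eq_square)
    qed
    have "mink (\<phi>u q) (\<phi>u q) * mink (\<phi>v q) (\<phi>v q) - (mink (\<phi>u q) (\<phi>v q))\<^sup>2 =
        ((1 + t\<^sup>2 + R\<^sup>2 * x\<^sup>2) * (1 + s\<^sup>2 + R\<^sup>2 * y\<^sup>2) - (- (s * t) + R\<^sup>2 * (x * y))\<^sup>2) / (R\<^sup>2)\<^sup>2"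
      unfolding E F G times_divide_times_eq power_divide diff_divide_distrib[symmetric] power2_eq_square[of "R\<^sup>2"] ..
    \<comment> \<open>After the equation for R^2, the Gram determinant becomes a sum of squares
      containing 1, hence positive whatever the slopes x and y are.\<close>
    also have "(1 + t\<^sup>2 + R\<^sup>2 * x\<^sup>2) * (1 + s\<^sup>2 + R\<^sup>2 * y\<^sup>2) - (- (s * t) + R\<^sup>2 * (x * y))\<^sup>2
        = (1 + s\<^sup>2 + t\<^sup>2) + R\<^sup>2 * (x\<^sup>2 + y\<^sup>2 + (s * x + t * y)\<^sup>2)"
      by (simp add: power2_eq_square algebra_simps)
    also have "\<dots> = R\<^sup>2 * (1 + x\<^sup>2 + y\<^sup>2 + (s * x + t * y)\<^sup>2)" unfolding R(2)[symmetric] by (simp add: distrib_left)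
    also have "\<dots> / (R\<^sup>2)\<^sup>2 > 0"
      using R(1) by (intro divide_pos_pos mult_pos_pos) (auto intro!: add_pos_nonneg)
    finally show "mink (\<phi>u q) (\<phi>u q) * mink (\<phi>v q) (\<phi>v q) - (mink (\<phi>u q) (\<phi>v q))\<^sup>2 > 0" .
  qed
  moreover have "homeomorphism UNIV (bowl_graph a \<inter> UNIV) \<phi> \<psi>"
  proof -
    have \<phi>\<psi>: "\<phi> (\<psi> x) = x" if x: "x \<in> bowl_graph a" for x
    proof -
      have x': "x $ 3 > 0" "(x$3)\<^sup>2 = 1 + (x$1)\<^sup>2 + (x$2)\<^sup>2" "x $ 4 = f (hcosh a x)"
        using x by (auto simp: bowl_graph_def HxR_def)
      then have r: "r (\<psi> x) = x $ 3" unfolding r_def \<psi>_def by (simp add: real_sqrt_unique)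
      have "hcosh a x = h (\<psi> x)" using a by (simp add: h_def r) (simp add: \<psi>_def hcosh_def mink_def vaxis_def)
      then show ?thesis using x'(3) r by (simp add: \<phi>_def vec_eq_iff forall_4) (simp add: \<psi>_def)
    qed
    have \<psi>\<phi>: "\<psi> (\<phi> q) = q" for q by (simp add: \<psi>_def \<phi>_def)
    have "hcosh a (\<phi> q) = h q" for q using a by (simp add: \<phi>_def h_def hcosh_def mink_def vaxis_def)
    then have "\<phi> q \<in> bowl_graph a" for q using \<phi>H[of q] by (simp add: bowl_graph_def) (simp add: \<phi>_def)
    moreover have "continuous_on UNIV \<phi>" unfolding \<phi>_def by (intro continuous_intros contr contf)
    moreover have "continuous_on (bowl_graph a) \<psi>" unfolding \<psi>_def by (intro continuous_intros)
    ultimately show ?thesis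
      using \<phi>\<psi> \<psi>\<phi> by (intro homeomorphismI) auto
  qed
  ultimately have "interior_chart (bowl_graph a) p" for p
    unfolding interior_chart_def by blast
  then show ?thesis by (auto simp: emb_surface_def bowl_graph_def)
qed

definition bowl_normal :: "real^4 \<Rightarrow> real^4 \<Rightarrow> real^4" where
  "bowl_normal a x = (1 / sqrt (1 + (g (hcosh a x))\<^sup>2 * ((hcosh a x)\<^sup>2 - 1))) *\<^sub>R graph_normal a (g (hcosh a x)) x"

lemma mink_bowl_normal_ez_pos:
  assumes "vaxis a" "x \<in> HxR"
  shows "mink (bowl_normal a x) ez > 0"
proof -
  note nf = graph_normal_facts[OF assms, of "g (hcosh a x)"]
  show ?thesis using nf(4) by (simp add: bowl_normal_def nf(2))
qed

text \<open>On the graph z - f(w) vanishes identically, so every point is both a maximum and a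
  minimum. The second order condition with \<sigma> = 1 and \<sigma> = -1 makes all second
  derivatives of z - f(w) vanish, and the soliton equation reduces to the profile equation. An
  arbitrary immersion is treated since \<open>translator\<close> tests all of them.\<close>

lemma bowl_chart:
  assumes a: "vaxis a" and C2: "C2_param U \<phi> \<phi>u \<phi>v \<phi>uu \<phi>uv \<phi>vv" and im: "immersion U \<phi> \<phi>u \<phi>v"
    and B: "\<phi> ` U \<subseteq> bowl_graph a" and q: "q \<in> U"
  shows "mink (bowl_normal a (\<phi> q)) (\<phi>u q) = 0" "mink (bowl_normal a (\<phi> q)) (\<phi>v q) = 0"
    "mean_curv (\<phi>u q) (\<phi>v q) (\<phi>uu q) (\<phi>uv q) (\<phi>vv q) (bowl_normal a (\<phi> q)) = mink (bowl_normal a (\<phi> q)) ez"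
proof -
  have imH: "\<phi> ` U \<subseteq> HxR" and gram: "mink (\<phi>u q) (\<phi>u q) * mink (\<phi>v q) (\<phi>v q) - (mink (\<phi>u q) (\<phi>v q))\<^sup>2 > 0"
    using im q by (auto simp: immersion_def)
  have x: "\<phi> q \<in> HxR" using imH q by blast
  note tan = chart_tangency[OF C2 imH q]
  have z: "\<phi> r $ 4 - f (hcosh a (\<phi> r)) = 0" if "r \<in> U" for r
    using B that by (auto simp: bowl_graph_def)
  define w where "w = hcosh a (\<phi> q)"
  define DXX where "DXX = \<phi>uu q $ 4 - g' w * (hcosh a (\<phi>u q))\<^sup>2 - g w * hcosh a (\<phi>uu q)"
  define DXY where "DXY = \<phi>uv q $ 4 - g' w * hcosh a (\<phi>u q) * hcosh a (\<phi>v q) - g w * hcosh a (\<phi>uv q)"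
  define DYY where "DYY = \<phi>vv q $ 4 - g' w * (hcosh a (\<phi>v q))\<^sup>2 - g w * hcosh a (\<phi>vv q)"
  have mx: "\<sigma> * (\<phi> r $ 4 - f (hcosh a (\<phi> r))) \<le> \<sigma> * (\<phi> q $ 4 - f (hcosh a (\<phi> q)))" if "r \<in> U" for r and \<sigma> :: real
    using z[OF that] z[OF q] by simp
  note chm = chart_height_max[OF C2 q f g mx, folded w_def]
  have "b\<^sup>2 * DXX + 2 * b * c * DXY + c\<^sup>2 * DYY = 0" for b c
    using chm(3)[of 1 b c] chm(3)[of "-1" b c] by (simp add: DXX_def DXY_def DYY_def)
  from this[of 1 0] this[of 0 1] this[of 1 1] have D0: "DXX = 0" "DYY = 0" "DXY = 0" by simp_all
  note mc = mean_curv_graph_normal[OF a x gram tan(1,2) chm(1)[of 1, unfolded w_def] chm(2)[of 1, unfolded w_def]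
      tan(3-5) DXX_def[unfolded w_def] DXY_def[unfolded w_def] DYY_def[unfolded w_def]]
  show "mink (bowl_normal a (\<phi> q)) (\<phi>u q) = 0" "mink (bowl_normal a (\<phi> q)) (\<phi>v q) = 0"
    using mc(2,3) by (simp_all add: bowl_normal_def)
  have "2 * mean_curv (\<phi>u q) (\<phi>v q) (\<phi>uu q) (\<phi>uv q) (\<phi>vv q) (graph_normal a (g w) (\<phi> q)) = radial_mean_curv (g w) (g' w) w"
    using mc(1) by (simp add: D0 radial_mean_curv_def w_def)
  also have "\<dots> = 2" using radial_mean_curv_bowl hcosh_ge_1[OF a x] by (simp add: w_def)
  finally show "mean_curv (\<phi>u q) (\<phi>v q) (\<phi>uu q) (\<phi>uv q) (\<phi>vv q) (bowl_normal a (\<phi> q)) = mink (bowl_normal a (\<phi> q)) ez"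
    using graph_normal_facts(2)[OF a x] by (simp add: bowl_normal_def mean_curv_scaleR w_def)
qed

lemma translator_bowl_graph:
  assumes a: "vaxis a"
  shows "translator (bowl_graph a) (bowl_normal a)"
proof -
  have conth: "continuous_on S (hcosh a)" for S
    using bounded_linear_hcosh by (rule linear_continuous_on)
  have conthp: "continuous_on S hpart" for S
    using bounded_linear_hpart by (rule linear_continuous_on)
  have pos: "1 \<le> 1 + (g (hcosh a x))\<^sup>2 * ((hcosh a x)\<^sup>2 - 1)" if "x \<in> bowl_graph a" for x
    using graph_normal_facts(4)[OF a] that by (simp add: bowl_graph_def)
  have gh: "continuous_on (bowl_graph a) (\<lambda>x. g (hcosh a x))"
    by (rule continuous_on_compose2[OF continuous_on_fg(2) conth subset_UNIV])
  have n0: "\<forall>x\<in>bowl_graph a. sqrt (1 + (g (hcosh a x))\<^sup>2 * ((hcosh a x)\<^sup>2 - 1)) \<noteq> 0"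
    using pos by force
  have "continuous_on (bowl_graph a) (bowl_normal a)"
    unfolding bowl_normal_def graph_normal_def by (intro continuous_intros gh conth conthp n0)
  moreover have "mink (bowl_normal a x) (bowl_normal a x) = 1" "mink (bowl_normal a x) (hpart x) = 0"
    if "x \<in> bowl_graph a" for x
  proof -
    have x: "x \<in> HxR" using that by (simp add: bowl_graph_def)
    note nf = graph_normal_facts[OF a x, of "g (hcosh a x)"]
    show "mink (bowl_normal a x) (bowl_normal a x) = 1" "mink (bowl_normal a x) (hpart x) = 0"
      using nf(4) by (simp_all add: bowl_normal_def nf)
  qed
  ultimately show ?thesis
    unfolding translator_def unit_normal_def
    by (intro conjI ballI allI impI; (elim conjE)?) (simp_all add: bowl_chart[OF a])
qed

end

section \<open>Rotations around the axis\<close>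

text \<open>The orbits of the rotations around the axis.\<close>

definition level :: "real^4 \<Rightarrow> real \<Rightarrow> real \<Rightarrow> (real^4) set" where
  "level a w z = {x\<in>HxR. hcosh a x = w \<and> x $ 4 = z}"

text \<open>An orthonormal basis of the tangent plane of the hyperbolic plane at a. Together with a
  and \<open>ez\<close> it diagonalises the form, so rotations become plane rotations.\<close>

definition rot_frame :: "real^4 \<Rightarrow> real^4 \<Rightarrow> real^4 \<Rightarrow> bool" where
  "rot_frame a e1 e2 \<longleftrightarrow> mink e1 e1 = 1 \<and> mink e2 e2 = 1 \<and> mink e1 e2 = 0 \<and> mink e1 a = 0 \<and> mink e2 a = 0
    \<and> e1 $ 4 = 0 \<and> e2 $ 4 = 0"

text \<open>The images of the first two basis vectors under the Lorentz boost taking (0,0,1) to a.\<close>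

lemma rot_frame_exists:
  assumes a: "vaxis a"
  obtains e1 e2 where "rot_frame a e1 e2"
proof -
  define d where "d = 1 + a$3"
  define e1 :: "real^4" where "e1 = vector [1 + a$1 * a$1 / d, a$1 * a$2 / d, a$1, 0]"
  define e2 :: "real^4" where "e2 = vector [a$1 * a$2 / d, 1 + a$2 * a$2 / d, a$2, 0]"
  have e1: "e1 $ 1 = 1 + a$1 * a$1 / d" "e1 $ 2 = a$1 * a$2 / d" "e1 $ 3 = a$1" "e1 $ 4 = 0"
    and e2: "e2 $ 1 = a$1 * a$2 / d" "e2 $ 2 = 1 + a$2 * a$2 / d" "e2 $ 3 = a$2" "e2 $ 4 = 0"
    by (simp_all add: e1_def e2_def vector_def)
  have d: "d > 0" using a by (simp add: d_def vaxis_def HxR_def)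
  have s: "a$1 * a$1 + a$2 * a$2 = d * (d - 2)" "a$3 = d - 1" "a$4 = 0"
    using a by (simp_all add: d_def vaxis_def HxR_def power2_eq_square algebra_simps)
  have q: "a$1 * a$1 / d + a$2 * a$2 / d = d - 2"
    using s(1) d by (simp add: add_divide_distrib[symmetric])
  define u v where "u = a$1" and "v = a$2"
  define k where "k = 1 / d"
  have kd: "k * d = 1" using d by (simp add: k_def)
  have k: "k * (u * u) + k * (v * v) = d - 2" using q by (simp add: k_def u_def v_def)
  have E: "x / d = k * x" for x by (simp add: k_def)
  have kk: "k * (u * u + v * v) = d - 2" using k by (simp add: distrib_left)
  \<comment> \<open>By \<open>kk\<close>, this is the bracket to which the three products of e1 and
    e2 reduce.\<close>
  have z: "2 * k + k * (d - 2) - 1 = 0" using kd by (simp add: algebra_simps)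
  have "mink e1 e1 = 1 + u * u * (2 * k + k * (k * (u * u + v * v)) - 1)"
    by (simp add: mink_def e1 E u_def[symmetric] v_def[symmetric] algebra_simps)
  then have 1: "mink e1 e1 = 1" by (simp add: kk z)
  have "mink e2 e2 = 1 + v * v * (2 * k + k * (k * (u * u + v * v)) - 1)"
    by (simp add: mink_def e2 E u_def[symmetric] v_def[symmetric] algebra_simps)
  then have 2: "mink e2 e2 = 1" by (simp add: kk z)
  have "mink e1 e2 = u * v * (2 * k + k * (k * (u * u + v * v)) - 1)"
    by (simp add: mink_def e1 e2 E u_def[symmetric] v_def[symmetric] algebra_simps)
  then have 3: "mink e1 e2 = 0" by (simp add: kk z)
  have "mink e1 a = u * (1 + k * (u * u + v * v) - (d - 1))" 
    by (simp add: mink_def e1 E s u_def[symmetric] v_def[symmetric] algebra_simps)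
  then have 4: "mink e1 a = 0" by (simp add: kk)
  have "mink e2 a = v * (1 + k * (u * u + v * v) - (d - 1))" 
    by (simp add: mink_def e2 E s u_def[symmetric] v_def[symmetric] algebra_simps)
  then have 5: "mink e2 a = 0" by (simp add: kk)
  show thesis using that[of e1 e2] 1 2 3 4 5 e1(4) e2(4) by (simp add: rot_frame_def)
qed

lemma rot_frame_expand:
  assumes a: "vaxis a" and e: "rot_frame a e1 e2"
  shows "x = mink x e1 *\<^sub>R e1 + mink x e2 *\<^sub>R e2 + hcosh a x *\<^sub>R a + x$4 *\<^sub>R ez"
proof -
  note A = vaxis_D[OF a]
  have fr: "mink e1 e1 = 1" "mink e2 e2 = 1" "mink e1 e2 = 0" "mink e2 e1 = 0" "mink e1 a = 0" "mink e2 a = 0"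
    "mink a e1 = 0" "mink a e2 = 0" "e1 $ 4 = 0" "e2 $ 4 = 0"
    using e by (simp_all add: rot_frame_def mink_commute)
  have aa: "mink a a = -1" using A(4) by (simp add: hcosh_def)
  obtain k b c d where x: "x = k *\<^sub>R hpart a + b *\<^sub>R e1 + c *\<^sub>R e2 + d *\<^sub>R ez"
    by (rule adapted_frame_spans[OF A(1), of e1 e2 ez]) (simp_all add: fr A(2,3))
  have "mink x e1 = b" "mink x e2 = c" "hcosh a x = k" "x $ 4 = d"
    using x by (simp_all add: A fr aa hcosh_def)
  then show ?thesis using x A(2) by simp
qed

lemma rot_frame_mink:
  assumes a: "vaxis a" and e: "rot_frame a e1 e2"
  shows "mink x y = mink x e1 * mink y e1 + mink x e2 * mink y e2 - hcosh a x * hcosh a y + x$4 * y$4"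
proof -
  have "mink x y = mink x (mink y e1 *\<^sub>R e1 + mink y e2 *\<^sub>R e2 + hcosh a y *\<^sub>R a + y$4 *\<^sub>R ez)"
    using rot_frame_expand[OF a e, of y] by simp
  also have "\<dots> = mink x e1 * mink y e1 + mink x e2 * mink y e2 - hcosh a x * hcosh a y + x$4 * y$4"
    by (simp add: hcosh_def)
  finally show ?thesis .
qed

text \<open>The radius \<open>sqrt (w\<^sup>2 - 1)\<close> is the hyperbolic sine of the distance to
  the axis. For w = 1 the circle collapses to a point of the axis.\<close>

definition level_param :: "real^4 \<Rightarrow> real^4 \<Rightarrow> real^4 \<Rightarrow> real \<Rightarrow> real \<Rightarrow> real^2 \<Rightarrow> real^4" where
  "level_param a e1 e2 w z k = sqrt (w\<^sup>2 - 1) *\<^sub>R (k$1 *\<^sub>R e1 + k$2 *\<^sub>R e2) + w *\<^sub>R a + z *\<^sub>R ez"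

lemma level_param_coords:
  assumes a: "vaxis a" and e: "rot_frame a e1 e2"
  shows "mink (level_param a e1 e2 w z k) e1 = sqrt (w\<^sup>2 - 1) * k$1"
    "mink (level_param a e1 e2 w z k) e2 = sqrt (w\<^sup>2 - 1) * k$2"
    "hcosh a (level_param a e1 e2 w z k) = w" "level_param a e1 e2 w z k $ 4 = z"
proof -
  note A = vaxis_D[OF a]
  have fr: "mink e1 e1 = 1" "mink e2 e2 = 1" "mink e1 e2 = 0" "mink e2 e1 = 0" "mink e1 a = 0" "mink e2 a = 0"
    "mink a e1 = 0" "mink a e2 = 0" "e1 $ 4 = 0" "e2 $ 4 = 0"
    using e by (simp_all add: rot_frame_def mink_commute)
  have aa: "mink a a = -1" using A(4) by (simp add: hcosh_def)
  show "mink (level_param a e1 e2 w z k) e1 = sqrt (w\<^sup>2 - 1) * k$1"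
    "mink (level_param a e1 e2 w z k) e2 = sqrt (w\<^sup>2 - 1) * k$2"
    "hcosh a (level_param a e1 e2 w z k) = w" "level_param a e1 e2 w z k $ 4 = z"
    by (simp_all add: level_param_def fr A aa hcosh_def)
qed

text \<open>On the other sheet of the hyperboloid the negative of x lies in \<open>HxR\<close>,
  which forces \<open>hcosh a x\<close> to be at most -1.\<close>

lemma HxR_if_hcosh_pos:
  assumes a: "vaxis a" and x: "mink x (hpart x) = -1" and h: "hcosh a x > 0"
  shows "x \<in> HxR"
proof -
  have sq: "(x$1)\<^sup>2 + (x$2)\<^sup>2 - (x$3)\<^sup>2 = -1" using x by (simp add: mink_def power2_eq_square)
  then have "(x$3)\<^sup>2 = 1 + (x$1)\<^sup>2 + (x$2)\<^sup>2" by simp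
  then have n0: "x$3 \<noteq> 0" using zero_le_power2[of "x$1"] zero_le_power2[of "x$2"] by force
  have "\<not> x$3 < 0"
  proof
    assume "x$3 < 0"
    then have "- x \<in> HxR" using sq by (simp add: HxR_def)
    from hcosh_ge_1[OF a this] h show False by (simp add: hcosh_def)
  qed
  then show ?thesis using sq n0 by (simp add: HxR_def)
qed

lemma level_param_image:
  assumes a: "vaxis a" and e: "rot_frame a e1 e2" and w: "w \<ge> 1"
  shows "level_param a e1 e2 w z ` sphere 0 1 = level a w z"
proof (intro equalityI subsetI)
  have w2: "0 \<le> w\<^sup>2 - 1" using w by simp
  fix x assume "x \<in> level_param a e1 e2 w z ` sphere 0 1"
  then obtain k where k: "norm k = 1" "x = level_param a e1 e2 w z k" by auto
  have k2: "(k$1)\<^sup>2 + (k$2)\<^sup>2 = 1"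
    using k(1) by (simp add: norm_eq_1 inner_vec_def sum_2 power2_eq_square)
  note c = level_param_coords[OF a e, of w z k, folded k(2)]
  have "mink x (hpart x) = mink x x - (x$4)\<^sup>2" by (simp add: mink_split[of x x] power2_eq_square)
  also have "\<dots> = sqrt (w\<^sup>2 - 1) * sqrt (w\<^sup>2 - 1) * ((k$1)\<^sup>2 + (k$2)\<^sup>2) - w\<^sup>2"
    unfolding rot_frame_mink[OF a e, of x x] c by (simp only: power2_eq_square algebra_simps)
  also have "sqrt (w\<^sup>2 - 1) * sqrt (w\<^sup>2 - 1) = w\<^sup>2 - 1" using w2 by simp
  finally have "mink x (hpart x) = -1" by (simp add: k2)
  then have "x \<in> HxR" using HxR_if_hcosh_pos[OF a] c(3) w by simp
  then show "x \<in> level a w z" using c by (simp add: level_def)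
next
  have w2: "0 \<le> w\<^sup>2 - 1" using w by simp
  fix x assume "x \<in> level a w z"
  then have x: "x \<in> HxR" "hcosh a x = w" "x $ 4 = z" by (auto simp: level_def)
  have "mink x x - (x$4)\<^sup>2 = -1" using HxR_D(1)[OF x(1)] by (simp add: mink_split[of x x] power2_eq_square)
  then have s: "(mink x e1)\<^sup>2 + (mink x e2)\<^sup>2 = w\<^sup>2 - 1"
    unfolding rot_frame_mink[OF a e, of x x] x(2) by (simp add: power2_eq_square)
  show "x \<in> level_param a e1 e2 w z ` sphere 0 1"
  proof (cases "w\<^sup>2 - 1 = 0")
    case True
    then have "mink x e1 = 0" "mink x e2 = 0" using s by (simp_all add: sum_power2_eq_zero_iff)
    then have "x = level_param a e1 e2 w z (axis 1 1)"
      using rot_frame_expand[OF a e, of x] True x by (simp add: level_param_def)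
    moreover have "axis 1 1 \<in> sphere (0::real^2) 1" by (simp add: norm_axis_1)
    ultimately show ?thesis by blast
  next
    case False
    define R where "R = sqrt (w\<^sup>2 - 1)"
    have R: "R > 0" "R\<^sup>2 = w\<^sup>2 - 1" using False w2 by (simp_all add: R_def)
    define k :: "real^2" where "k = vector [mink x e1 / R, mink x e2 / R]"
    have kn: "k$1 = mink x e1 / R" "k$2 = mink x e2 / R" by (simp_all add: k_def)
    have "(k$1)\<^sup>2 + (k$2)\<^sup>2 = 1"
      unfolding kn power_divide add_divide_distrib[symmetric] s R(2)[symmetric] using R(1) by simp
    then have "k \<in> sphere 0 1" by (simp add: norm_eq_1 inner_vec_def sum_2 power2_eq_square)
    moreover have "x = level_param a e1 e2 w z k"
      using rot_frame_expand[OF a e, of x] R x(2,3) 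
      by (simp add: level_param_def kn R_def[symmetric] scaleR_add_right)
    ultimately show ?thesis by blast
  qed
qed

lemma continuous_on_level_param: "continuous_on S (level_param a e1 e2 w z)"
  unfolding level_param_def by (intro continuous_intros)

lemma connected_level:
  assumes "vaxis a"
  shows "connected (level a w z)"
proof (cases "w \<ge> 1")
  case True
  obtain e1 e2 where e: "rot_frame a e1 e2" using rot_frame_exists[OF assms] .
  have "connected (sphere (0::real^2) 1)" by (intro connected_sphere) simp
  from connected_continuous_image[OF continuous_on_level_param this]
  show ?thesis using level_param_image[OF assms e True] by metis
next
  case False
  then have "level a w z = {}" using hcosh_ge_1[OF assms] by (auto simp: level_def)
  then show ?thesis by simp
qed

section \<open>The rotation group and its orbits\<close>

lemma vrot_preserves:
  assumes a: "vaxis a" and R: "vrot a R"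
  shows "hcosh a (R x) = hcosh a x" "R x $ 4 = x $ 4" "R x \<in> HxR \<longleftrightarrow> x \<in> HxR"
proof -
  have m: "mink (R x) (R y) = mink x y" for x y using R by (simp add: vrot_def)
  show h: "hcosh a (R x) = hcosh a x" using m[of x a] R by (simp add: vrot_def hcosh_def)
  show z: "R x $ 4 = x $ 4" using m[of x ez] R by (simp add: vrot_def)
  have p: "mink (R x) (hpart (R x)) = mink x (hpart x)"
    using m[of x x] mink_split[of x x] mink_split[of "R x" "R x"] z by simp
  show "R x \<in> HxR \<longleftrightarrow> x \<in> HxR"
    using p h HxR_D HxR_if_hcosh_pos[OF a] hcosh_ge_1[OF a] by (metis zero_less_one less_le_trans)
qed

text \<open>Rotations preserve w and the height, so they map each orbit into itself. The determinant
  condition makes them bijective, which supplies the preimages for the reverse inclusion.\<close>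

lemma rot_invariant_if_union_of_levels:
  assumes a: "vaxis a" and S: "S \<subseteq> HxR"
    and sat: "\<And>x. x \<in> S \<Longrightarrow> level a (hcosh a x) (x $ 4) \<subseteq> S"
  shows "rot_invariant a S"
  unfolding rot_invariant_def
proof (intro allI impI equalityI subsetI)
  fix R x assume R: "vrot a R"
  note V = vrot_preserves[OF a R]
  { assume "x \<in> R ` S"
    then obtain y where y: "y \<in> S" "x = R y" by auto
    then have "x \<in> level a (hcosh a y) (y $ 4)" using S by (auto simp: level_def V)
    then show "x \<in> S" using sat y(1) by blast }
  { assume x: "x \<in> S"
    have lin: "linear R" and det: "det (matrix R) = 1" using R by (auto simp: vrot_def)
    have "invertible (matrix R)" using det by (simp add: invertible_det_nz)
    then have "bij R" using lin by (metis matrix_vector_mul(2) invertible_eq_bij)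
    then obtain y where y: "x = R y" using bij_is_surj surjD by metis
    then have "y \<in> level a (hcosh a x) (x $ 4)" using x S V[of y] by (auto simp: level_def)
    then show "x \<in> R ` S" using sat[OF x] y by blast }
qed

text \<open>With J the diagonal matrix of the form, invariance reads R^T J R = J; take
  determinants.\<close>

lemma det_lorentz:
  assumes lin: "linear R" and m: "\<And>x y. mink (R x) (R y) = mink x y"
  shows "(det (matrix R))\<^sup>2 = 1"
proof -
  define j :: "real^4 \<Rightarrow> real^4" where "j x = vector [x$1, x$2, - x$3, x$4]" for x
  have jn: "j x $ 1 = x$1" "j x $ 2 = x$2" "j x $ 3 = - x$3" "j x $ 4 = x$4" for x
    by (simp_all add: j_def vector_def)
  have linj: "linear j" by (rule linearI) (simp_all add: vec_eq_iff forall_4 jn)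
  have mj: "mink x y = x \<bullet> j y" for x y by (simp add: inner_vec_def sum_4 jn mink_def)
  define J where "J = matrix j"
  have J: "J *v x = j x" for x using linj by (simp add: J_def matrix_works linear_def scalar_mult_eq_scaleR)
  have R: "matrix R *v x = R x" for x using lin by (simp add: matrix_works linear_def scalar_mult_eq_scaleR)
  have "x \<bullet> ((transpose (matrix R) ** J ** matrix R) *v y) = x \<bullet> (J *v y)" for x y
    using m[of x y] unfolding mj
    by (simp add: matrix_vector_mul_assoc[symmetric] J R dot_lmul_matrix[symmetric] inner_commute)
      (metis J R dot_lmul_matrix inner_commute vector_transpose_matrix transpose_transpose)
  then have "(transpose (matrix R) ** J ** matrix R) *v y = J *v y" for y
    by (metis vector_eq_ldot)
  then have "transpose (matrix R) ** J ** matrix R = J" by (simp add: matrix_eq)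
  then have "det (matrix R) * det J * det (matrix R) = det J" by (metis det_mul det_transpose)
  moreover have "J ** J = mat 1"
    by (simp add: matrix_eq matrix_vector_mul_assoc[symmetric] J) (simp add: vec_eq_iff forall_4 jn)
  then have "det J * det J = 1" by (metis det_mul det_I)
  then have "det J \<noteq> 0" by auto
  ultimately show ?thesis by (simp add: power2_eq_square)
qed

text \<open>The plane rotation by the angle t in the span of e1 and e2, the identity on a and
  \<open>ez\<close>; written as x plus a correction, so that only the components in that plane
  occur.\<close>

definition axis_rotation :: "real^4 \<Rightarrow> real^4 \<Rightarrow> real \<Rightarrow> real^4 \<Rightarrow> real^4" where
  "axis_rotation e1 e2 t x = x + (cos t - 1) *\<^sub>R (mink x e1 *\<^sub>R e1 + mink x e2 *\<^sub>R e2)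
     + sin t *\<^sub>R (mink x e1 *\<^sub>R e2 - mink x e2 *\<^sub>R e1)"

lemma axis_rotation_coords:
  assumes a: "vaxis a" and e: "rot_frame a e1 e2"
  shows "mink (axis_rotation e1 e2 t x) e1 = cos t * mink x e1 - sin t * mink x e2"
    "mink (axis_rotation e1 e2 t x) e2 = sin t * mink x e1 + cos t * mink x e2"
    "hcosh a (axis_rotation e1 e2 t x) = hcosh a x" "axis_rotation e1 e2 t x $ 4 = x $ 4"
proof -
  have fr: "mink e1 e1 = 1" "mink e2 e2 = 1" "mink e1 e2 = 0" "mink e2 e1 = 0" "mink e1 a = 0" "mink e2 a = 0"
    "e1 $ 4 = 0" "e2 $ 4 = 0"
    using e by (simp_all add: rot_frame_def mink_commute)
  show "mink (axis_rotation e1 e2 t x) e1 = cos t * mink x e1 - sin t * mink x e2"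
    "mink (axis_rotation e1 e2 t x) e2 = sin t * mink x e1 + cos t * mink x e2"
    "hcosh a (axis_rotation e1 e2 t x) = hcosh a x" "axis_rotation e1 e2 t x $ 4 = x $ 4"
    by (simp_all add: axis_rotation_def fr hcosh_def algebra_simps)
qed

lemma rot_frame_eqI:
  assumes a: "vaxis a" and e: "rot_frame a e1 e2"
    and "mink x e1 = mink y e1" "mink x e2 = mink y e2" "hcosh a x = hcosh a y" "x $ 4 = y $ 4"
  shows "x = y"
  using rot_frame_expand[OF a e, of x] rot_frame_expand[OF a e, of y] assms(3-) by simp

lemma axis_rotation_add:
  assumes a: "vaxis a" and e: "rot_frame a e1 e2"
  shows "axis_rotation e1 e2 s (axis_rotation e1 e2 t x) = axis_rotation e1 e2 (s + t) x"
  by (rule rot_frame_eqI[OF a e])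
    (simp_all add: axis_rotation_coords[OF a e] cos_add sin_add algebra_simps)

lemma vrot_axis_rotation:
  assumes a: "vaxis a" and e: "rot_frame a e1 e2"
  shows "vrot a (axis_rotation e1 e2 t)"
proof -
  have lin: "linear (axis_rotation e1 e2 t)" for t
    by (rule linearI) (simp_all add: axis_rotation_def algebra_simps)
  have m: "mink (axis_rotation e1 e2 t x) (axis_rotation e1 e2 t y) = mink x y" for t x y
  proof -
    have "(c * p - s * q) * (c * p' - s * q') + (s * p + c * q) * (s * p' + c * q')
        = (s\<^sup>2 + c\<^sup>2) * (p * p' + q * q')" for c s p q p' q' :: real
      by (simp add: power2_eq_square algebra_simps)
    then show ?thesis
      unfolding rot_frame_mink[OF a e, of x y] rot_frame_mink[OF a e, of "axis_rotation e1 e2 t x"] axis_rotation_coords[OF a e]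
      by simp
  qed
  \<comment> \<open>Invariance of the form only gives determinant 1 or -1. Writing the rotation as
    the square of the half-angle rotation excludes -1 without expanding a determinant.\<close>
  have "axis_rotation e1 e2 t = axis_rotation e1 e2 (t/2) \<circ> axis_rotation e1 e2 (t/2)"
    by (simp add: fun_eq_iff axis_rotation_add[OF a e])
  then have "matrix (axis_rotation e1 e2 t) = matrix (axis_rotation e1 e2 (t/2)) ** matrix (axis_rotation e1 e2 (t/2))"
    using matrix_compose[OF lin lin] by metis
  then have "det (matrix (axis_rotation e1 e2 t)) = (det (matrix (axis_rotation e1 e2 (t/2))))\<^sup>2"
    by (simp add: det_mul power2_eq_square)
  also have "\<dots> = 1" by (rule det_lorentz[OF lin m])
  finally have det: "det (matrix (axis_rotation e1 e2 t)) = 1" .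
  have fr: "mink a e1 = 0" "mink a e2 = 0" "e1 $ 4 = 0" "e2 $ 4 = 0"
    using e by (simp_all add: rot_frame_def mink_commute)
  have "axis_rotation e1 e2 t ez = ez" "axis_rotation e1 e2 t a = a"
    by (simp_all add: axis_rotation_def fr)
  with lin m det show ?thesis unfolding vrot_def by blast
qed

text \<open>Rotations act transitively on each circle: the rotation by the difference of the two
  angles carries x to y.\<close>

lemma level_subset_rot_invariant:
  assumes a: "vaxis a" and S: "rot_invariant a S" and x: "x \<in> S" "x \<in> HxR"
  shows "level a (hcosh a x) (x $ 4) \<subseteq> S"
proof
  fix y assume y: "y \<in> level a (hcosh a x) (x $ 4)"
  obtain e1 e2 where e: "rot_frame a e1 e2" using rot_frame_exists[OF a] .
  define w z where "w = hcosh a x" and "z = x $ 4"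
  have w: "w \<ge> 1" using hcosh_ge_1[OF a x(2)] by (simp add: w_def)
  have ang: "\<exists>t. u = level_param a e1 e2 w z (vector [cos t, sin t])" if "u \<in> level a w z" for u
  proof -
    obtain k where k: "norm k = 1" "u = level_param a e1 e2 w z k"
      using \<open>u \<in> level a w z\<close> unfolding level_param_image[OF a e w, symmetric] by auto
    have "(k$1)\<^sup>2 + (k$2)\<^sup>2 = 1"
      using k(1) by (simp add: norm_eq_1 inner_vec_def sum_2 power2_eq_square)
    then obtain t where "k$1 = cos t" "k$2 = sin t" using sincos_total_2pi by metis
    then have "k = vector [cos t, sin t]" by (simp add: vec_eq_iff forall_2)
    then show ?thesis using k(2) by blast
  qed
  have "x \<in> level a w z" using x(2) by (simp add: level_def w_def z_def)
  with ang obtain s where s: "x = level_param a e1 e2 w z (vector [cos s, sin s])" by blast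
  from ang y obtain t where t: "y = level_param a e1 e2 w z (vector [cos t, sin t])"
    by (auto simp: w_def z_def)
  have "axis_rotation e1 e2 (t - s) x = y"
  proof (rule rot_frame_eqI[OF a e])
    have "cos t = cos ((t - s) + s)" "sin t = sin ((t - s) + s)" by simp_all
    then have cs: "cos t = cos (t - s) * cos s - sin (t - s) * sin s" 
      "sin t = sin (t - s) * cos s + cos (t - s) * sin s" by (simp_all only: cos_add sin_add)
    show "mink (axis_rotation e1 e2 (t - s) x) e1 = mink y e1" 
      "mink (axis_rotation e1 e2 (t - s) x) e2 = mink y e2"
      unfolding axis_rotation_coords[OF a e] s t level_param_coords[OF a e] vector_2
      by (subst cs; simp only: algebra_simps)+
  qed (simp_all add: axis_rotation_coords[OF a e] s t level_param_coords[OF a e])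
  then show "y \<in> S" using S vrot_axis_rotation[OF a e] x(1) unfolding rot_invariant_def by blast
qed

text \<open>The curve has a point off the axis, for the axis meets the height t0 only once and
  \<gamma> is injective; the orbit of that point is a genuine circle inside the curve. Were the
  inclusion proper, removing one missed point would embed this circle into the real line, which is
  impossible.\<close>

lemma rot_invariant_closed_curve:
  assumes a: "vaxis a" and \<Gamma>: "closed_emb_curve \<Gamma>" "\<Gamma> \<subseteq> {x\<in>HxR. x $ 4 = t0}" and rot: "rot_invariant a \<Gamma>"
  obtains w where "\<Gamma> = level a w t0"
proof -
  obtain e1 e2 where e: "rot_frame a e1 e2" using rot_frame_exists[OF a] .
  obtain \<gamma> :: "real^2 \<Rightarrow> real^4" where \<gamma>: "continuous_on (sphere 0 1) \<gamma>" "inj_on \<gamma> (sphere 0 1)" "\<Gamma> = \<gamma> ` sphere 0 1"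
    using \<Gamma>(1) unfolding closed_emb_curve_def by blast
  have "\<exists>x\<in>\<Gamma>. hcosh a x \<noteq> 1"
  proof (rule ccontr)
    assume "\<not> ?thesis"
    then have "\<Gamma> \<subseteq> level a 1 t0" using \<Gamma>(2) by (auto simp: level_def)
    also have "\<dots> = level_param a e1 e2 1 t0 ` sphere 0 1" using level_param_image[OF a e] by simp
    finally have one: "x = y" if "x \<in> \<Gamma>" "y \<in> \<Gamma>" for x y using that by (auto simp: level_param_def)
    have ax: "axis 1 1 \<in> sphere (0::real^2) 1" "axis 2 1 \<in> sphere (0::real^2) 1" by (simp_all add: norm_axis_1)
    then have "\<gamma> (axis 1 1) = \<gamma> (axis 2 1)" using one \<gamma>(3) by blast
    then have "axis 1 1 = (axis 2 1 :: real^2)" using \<gamma>(2) ax by (simp add: inj_on_eq_iff)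
    then show False by (simp add: axis_eq_axis)
  qed
  then obtain x where x: "x \<in> \<Gamma>" "hcosh a x \<noteq> 1" by blast
  have xH: "x \<in> HxR" "x $ 4 = t0" using x(1) \<Gamma>(2) by auto
  define w where "w = hcosh a x"
  have w: "w > 1" using hcosh_ge_1[OF a xH(1)] x(2) by (simp add: w_def)
  have sub: "level a w t0 \<subseteq> \<Gamma>" using level_subset_rot_invariant[OF a rot x(1) xH(1)] xH(2) by (simp add: w_def)
  have "\<Gamma> \<subseteq> level a w t0"
  proof (rule ccontr)
    assume "\<not> \<Gamma> \<subseteq> level a w t0"
    then obtain p where p: "p \<in> \<Gamma>" "p \<notin> level a w t0" by blast
    obtain \<delta> where hom: "homeomorphism (sphere 0 1) \<Gamma> \<gamma> \<delta>"
      using homeomorphism_compact[OF compact_sphere \<gamma>(1) \<gamma>(3)[symmetric] \<gamma>(2)] by blast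
    have dp: "\<delta> p \<in> sphere 0 1" using hom p(1) by (auto simp: homeomorphism_def)
    have "(sphere 0 1 - {\<delta> p}) homeomorphic (UNIV :: real set)"
      by (rule homeomorphic_punctured_sphere_affine[OF _ dp]) (simp_all add: aff_dim_UNIV)
    then obtain h h' where h: "homeomorphism (sphere 0 1 - {\<delta> p}) (UNIV :: real set) h h'"
      unfolding homeomorphic_def by blast
    let ?P = "level_param a e1 e2 w t0"
    have P: "?P ` sphere 0 1 = level a w t0" using level_param_image[OF a e] w by simp
    have injP: "inj_on ?P (sphere 0 1)"
    proof (rule inj_onI)
      fix k k' assume eq: "?P k = ?P k'"
      have "sqrt (w\<^sup>2 - 1) > 0" using w by simp
      then show "k = k'"
        using level_param_coords(1,2)[OF a e, of w t0 k] level_param_coords(1,2)[OF a e, of w t0 k'] eq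
        by (simp add: vec_eq_iff forall_2)
    qed
    have d: "continuous_on (level a w t0) \<delta>" "inj_on \<delta> (level a w t0)" 
      "\<delta> ` level a w t0 \<subseteq> sphere 0 1 - {\<delta> p}"
    proof -
      have "continuous_on \<Gamma> \<delta>" "\<And>y. y \<in> \<Gamma> \<Longrightarrow> \<gamma> (\<delta> y) = y" "\<delta> ` \<Gamma> = sphere 0 1"
        using hom by (auto simp: homeomorphism_def)
      then show "continuous_on (level a w t0) \<delta>" "inj_on \<delta> (level a w t0)" "\<delta> ` level a w t0 \<subseteq> sphere 0 1 - {\<delta> p}"
        using sub p by (auto intro: continuous_on_subset inj_on_inverseI[where g=\<gamma>]) (metis subsetD)+
    qed
    have hc: "continuous_on (sphere 0 1 - {\<delta> p}) h" "inj_on h (sphere 0 1 - {\<delta> p})"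
      using h by (auto simp: homeomorphism_def intro: inj_on_inverseI[where g=h'])
    have "continuous_on (sphere 0 1) (h \<circ> (\<delta> \<circ> ?P))"
      using P d by (intro continuous_on_compose continuous_on_level_param) 
        (auto simp: image_comp[symmetric] intro: continuous_on_subset[OF hc(1)])
    moreover have "inj_on (h \<circ> (\<delta> \<circ> ?P)) (sphere 0 1)"
      using P d injP by (intro comp_inj_on) (auto simp: image_comp[symmetric] intro: inj_on_subset[OF hc(2)])
    ultimately have "DIM(real^2) \<le> DIM(real)"
      by (intro no_embedding_sphere_lowdim[of 0 1]) auto
    then show False by simp
  qed
  with sub show thesis using that[of w] by blast
qed

section \<open>Rotational symmetry of the soliton\<close>

lemma HxR_graph_eqI:
  assumes a: "vaxis a" and x: "x \<in> HxR" and y: "y \<in> HxR" and eq: "x$1 = y$1" "x$2 = y$2"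
    and h: "x $ 4 - f (hcosh a x) = y $ 4 - f (hcosh a y)"
  shows "x = y"
proof -
  have "(x$3)\<^sup>2 = 1 + (x$1)\<^sup>2 + (x$2)\<^sup>2" "(y$3)\<^sup>2 = 1 + (y$1)\<^sup>2 + (y$2)\<^sup>2" "x$3 > 0" "y$3 > 0"
    using x y by (simp_all add: HxR_def)
  then have "(x$3)\<^sup>2 = (y$3)\<^sup>2" "0 \<le> x$3" "0 \<le> y$3" by (simp_all only: eq less_imp_le)
  then have 3: "x$3 = y$3" by (rule power2_eq_imp_eq)
  then have "hcosh a x = hcosh a y" using a eq by (simp add: hcosh_def mink_def vaxis_def)
  then show ?thesis using eq 3 h by (simp add: vec_eq_iff forall_4)
qed

text \<open>Away from its boundary, M is open in the graph by invariance of domain, and it is closed;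
so it contains every level circle that it meets.\<close>

lemma level_subset_compact_graph:
  assumes a: "vaxis a" and M: "compact M" "M \<subseteq> HxR"
    and graph: "\<And>x. x \<in> M \<Longrightarrow> x $ 4 - f (hcosh a x) = c"
    and x: "x \<in> M" and int: "\<And>y. y \<in> level a (hcosh a x) (x $ 4) \<Longrightarrow> y \<in> M \<Longrightarrow> interior_chart M y"
  shows "level a (hcosh a x) (x $ 4) \<subseteq> M"
proof -
  define L where "L = level a (hcosh a x) (x $ 4)"
  define \<pi> where "\<pi> y = (y$1, y$2)" for y :: "real^4"
  have cont\<pi>: "continuous_on S \<pi>" for S unfolding \<pi>_def by (intro continuous_intros)
  have graphL: "y \<in> HxR" "y $ 4 - f (hcosh a y) = c" if "y \<in> L" for y
    using that graph[OF x] by (auto simp: L_def level_def)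
  \<comment> \<open>M and the circle L lie on the same graph over the first two coordinates, so a
    point of L that projects into the image of a chart of M is itself a point of M.\<close>
  have inj: "y = z" if "y \<in> M \<union> L" "z \<in> M \<union> L" "\<pi> y = \<pi> z" for y z
    using that graph graphL M(2) by (intro HxR_graph_eqI[OF a, where f=f]) (auto simp: \<pi>_def)
  have "closedin (top_of_set L) (L \<inter> M)"
    using M(1) by (simp add: closedin_closed_Int compact_imp_closed)
  moreover have "openin (top_of_set L) (L \<inter> M)"
  proof (subst openin_subopen, intro ballI)
    fix y assume y: "y \<in> L \<inter> M"
    then have "interior_chart M y" using int by (simp add: L_def)
    then obtain U V \<phi> \<phi>u \<phi>v \<phi>uu \<phi>uv \<phi>vv \<psi> where C2: "C2_param U \<phi> \<phi>u \<phi>v \<phi>uu \<phi>uv \<phi>vv"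
      and V: "y \<in> V" and hom: "homeomorphism U (M \<inter> V) \<phi> \<psi>"
      unfolding interior_chart_def by blast
    have U: "open U" using C2 by (simp add: C2_param_def)
    have \<phi>: "continuous_on U \<phi>" "\<phi> ` U = M \<inter> V" "inj_on \<phi> U"
      using hom by (auto simp: homeomorphism_def intro: inj_on_inverseI[where g=\<psi>])
    have "continuous_on U (\<pi> \<circ> \<phi>)" by (intro continuous_on_compose \<phi> cont\<pi>)
    moreover have "inj_on (\<pi> \<circ> \<phi>) U"
    proof (rule comp_inj_on[OF \<phi>(3)], rule inj_onI)
      fix u v assume "u \<in> \<phi> ` U" "v \<in> \<phi> ` U" "\<pi> u = \<pi> v"
      then show "u = v" using \<phi>(2) inj by blast
    qed
    \<comment> \<open>Injectivity turns the projected chart into a map between open sets of equal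
      dimension, so invariance of domain applies.\<close>
    ultimately have op: "open ((\<pi> \<circ> \<phi>) ` U)" using U by (intro invariance_of_domain)
    have "openin (top_of_set L) (L \<inter> \<pi> -` ((\<pi> \<circ> \<phi>) ` U))"
      by (rule continuous_openin_preimage_gen[OF cont\<pi> op])
    moreover have "y \<in> L \<inter> \<pi> -` ((\<pi> \<circ> \<phi>) ` U)"
    proof -
      have "y \<in> \<phi> ` U" using y V \<phi>(2) by simp
      then show ?thesis using y by auto
    qed
    moreover have "L \<inter> \<pi> -` ((\<pi> \<circ> \<phi>) ` U) \<subseteq> L \<inter> M"
    proof
      fix z assume z: "z \<in> L \<inter> \<pi> -` ((\<pi> \<circ> \<phi>) ` U)"
      then obtain u where u: "u \<in> U" "\<pi> z = \<pi> (\<phi> u)" by auto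
      have "\<phi> u \<in> M" using u(1) \<phi>(2) by blast
      then show "z \<in> L \<inter> M" using inj[of z "\<phi> u"] z u(2) by auto
    qed
    ultimately show "\<exists>T. openin (top_of_set L) T \<and> y \<in> T \<and> T \<subseteq> L \<inter> M" by blast
  qed
  moreover have "x \<in> L \<inter> M" using x M(2) by (auto simp: L_def level_def)
  ultimately have "L \<inter> M = L"
    using connected_level[OF a] unfolding L_def connected_clopen by blast
  then show ?thesis unfolding L_def by blast
qed

lemma (in bowl_profile) bowl_bowl_graph:
  assumes a: "vaxis a"
  shows "bowl (bowl_graph a)"
  unfolding bowl_def
proof (intro conjI)
  show "\<exists>u. bowl_graph a = vgraph u" using bowl_graph_eq_vgraph[OF a] by blast
  show "emb_surface (bowl_graph a)" by (rule emb_surface_bowl_graph[OF a])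
  show "\<exists>\<eta>. translator (bowl_graph a) \<eta> \<and> (\<forall>p\<in>bowl_graph a. mink (\<eta> p) ez > 0)"
    using translator_bowl_graph[OF a] mink_bowl_normal_ez_pos[OF a] by (auto simp: bowl_graph_def)
  have "rot_invariant a (bowl_graph a)"
    by (rule rot_invariant_if_union_of_levels[OF a]) (auto simp: bowl_graph_def level_def)
  then show "\<exists>a'. vaxis a' \<and> rot_invariant a' (bowl_graph a)" using a by blast
qed

lemma bowl_profile_locale_exists:
  obtains f g g' where "bowl_profile f g g'"
proof -
  obtain g g' :: "real \<Rightarrow> real"
  where g: "\<And>w. (g has_real_derivative g' w) (at w)" "continuous_on UNIV g'"
    "\<And>w. w \<ge> 1 \<Longrightarrow> 0 \<le> g w" "\<And>w. w \<ge> 1 \<Longrightarrow> g w * w \<le> 2"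
    "\<And>w. w \<ge> 1 \<Longrightarrow> (w\<^sup>2 - 1) * g' w = (2 - g w * w) * (1 + (g w)\<^sup>2 * (w\<^sup>2 - 1)) - g w * w"
    by (rule bowl_profile_exists) (rule that)
  have "isCont g x" for x using g(1) DERIV_isCont by blast
  then obtain f where "\<And>w. (f has_vector_derivative g w) (at w)"
    using einterval_antiderivative[of "-\<infinity>" "\<infinity>" g] by auto
  then have "bowl_profile f g g'"
    using g by unfold_locales (auto simp: has_real_derivative_iff_has_vector_derivative)
  then show thesis by (rule that)
qed

theorem theorem5p4:
  fixes \<Gamma> M :: "(real^4) set" and a :: "real^4" and t0 :: real
  assumes "vaxis a"
    and "closed_emb_curve \<Gamma>" and "\<Gamma> \<subseteq> {x\<in>HxR. x$4 = t0}" and "rot_invariant a \<Gamma>"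
    and "compact M" and "emb_surface_bdry M" and "\<exists>\<eta>. translator M \<eta>"
    and "mbdry M = \<Gamma>"
  shows "rot_invariant a M \<and>
         (\<exists>B c. bowl B \<and> M \<subseteq> (\<lambda>x. x + c *\<^sub>R ez) ` B)"
proof -
  note a = \<open>vaxis a\<close>
  obtain w0 where w0: "\<Gamma> = level a w0 t0"
    using rot_invariant_closed_curve[OF assms(1-4)] by blast
  obtain f g g' where "bowl_profile f g g'" by (rule bowl_profile_locale_exists)
  then interpret bowl_profile f g g' .
  obtain \<eta> where \<eta>: "translator M \<eta>" using assms(7) by blast
  have M: "M \<subseteq> HxR" using assms(6) by (simp add: emb_surface_bdry_def)
  have bd: "hcosh a x = w0 \<and> x $ 4 = t0" if "x \<in> mbdry M" for x
    using that assms(8) w0 by (auto simp: level_def)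
  define c where "c = t0 - f w0"
  have on_bowl: "x $ 4 - f (hcosh a x) = c" if "x \<in> M" for x
    unfolding c_def by (rule translator_on_bowl[OF a assms(5) M \<eta> bd that])
  have "rot_invariant a M"
  proof (rule rot_invariant_if_union_of_levels[OF a M])
    fix x assume x: "x \<in> M"
    show "level a (hcosh a x) (x $ 4) \<subseteq> M"
    \<comment> \<open>The boundary is itself an orbit, so the orbit of x either equals it or avoids
      it; in the second case all its points in M are interior.\<close>
    proof (cases "x \<in> \<Gamma>")
      case True
      then have "level a (hcosh a x) (x $ 4) = \<Gamma>" by (auto simp: w0 level_def)
      then show ?thesis using assms(8) by (auto simp: mbdry_def)
    next
      case False
      have "interior_chart M y" if "y \<in> level a (hcosh a x) (x $ 4)" "y \<in> M" for y
      proof -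
        have "y \<notin> \<Gamma>" using False that(1) x M by (auto simp: w0 level_def)
        then show ?thesis using that(2) assms(8) by (auto simp: mbdry_def)
      qed
      from level_subset_compact_graph[OF a assms(5) M on_bowl x this] show ?thesis by blast
    qed
  qed
  moreover have "M \<subseteq> (\<lambda>x. x + c *\<^sub>R ez) ` bowl_graph a"
  proof
    fix x assume x: "x \<in> M"
    have "hcosh a (x - c *\<^sub>R ez) = hcosh a x"
      using vaxis_D(3)[OF a] by (simp add: hcosh_def)
    then have "x - c *\<^sub>R ez \<in> bowl_graph a"
      using x M on_bowl[OF x] by (auto simp: bowl_graph_def HxR_def)
    then show "x \<in> (\<lambda>x. x + c *\<^sub>R ez) ` bowl_graph a" by (rule rev_image_eqI) simp
  qed
  ultimately show ?thesis using bowl_bowl_graph[OF a] by blast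
qed

end
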